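(* Let $M_R$ be a module over a ring $R$ and $S=\mathrm{End}_R(M)$. The following conditions are equivalent: (1) $M$ is weakly perspective. (2) For every idempotent $e=e^2\in S$ and every split epimorphism $\phi:M\to eM$ with $\mathrm{Ker}(\phi)\cong(1-e)M$, there exists a splitting $\psi$ of $\phi$ such that $M=\mathrm{Im}(\psi)\oplus(1-e)M$. (3) For every idempotent $e=e^2\in S$ and every split epimorphism $\phi:M\to eM$ with $\mathrm{Ker}(\phi)\cong(1-e)M$, there exists a splitting $\psi$ of $\phi$ such that $e\psi$ is an automorphism of $eM$. (4) Whenever $euse=e$ for some $e=e^2\in S$, $s\in S$ and $u\in \mathrm{U}(S)$, there exists $t\in S$ such that $eute=e$ and $ete\in \mathrm{U}(eSe)$.
   Context: Rings are associative with unity and modules are unital; $\mathrm{U}(\cdot)$ denotes the group of units of a ring, and endomorphisms act on the left of $M$. A module $M$ is weakly perspective if any two isomorphic direct summands of $M$ that have isomorphic complements have a common complement in $M$; that is, if $M=A\oplus A_1=B\oplus B_1$ with $A\cong B$ and $A_1\cong B_1$, then there is a submodule $C$ with $M=A\oplus C=B\oplus C$. A splitting of an epimorphism $\phi:M\to eM$ is a homomorphism $\psi:eM\to M$ with $\phi\psi=\mathrm{id}_{eM}$; $\phi$ is a split epimorphism if it has a splitting. *)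

theory Defs
  imports "HOL-Algebra.Module" "HOL-Algebra.AbelCoset"
begin

text \<open>
  The library locale \<^locale>\<open>module\<close> requires a commutative ring of scalars. Here \<open>R\<close> is an arbitrary
  unital ring and \<open>M\<close> a right \<open>R\<close>-module. The library's module record is reused, with
  \<open>a \<odot>\<^bsub>M\<^esub> x\<close> standing for \<open>x \<cdot> a\<close>; hence the order of the scalars in \<open>smult_assoc\<close>,
  which says \<open>x \<cdot> (a b) = (x \<cdot> a) \<cdot> b\<close>.
  The ring and module may be trivial. The multiplicative fields of the record \<open>M\<close> play no role.
\<close>

locale right_module = R?: ring R + M?: abelian_group M for R (structure) and M (structure) +
  assumes smult_closed [simp, intro]:
      "\<lbrakk>a \<in> carrier R; x \<in> carrier M\<rbrakk> \<Longrightarrow> a \<odot>\<^bsub>M\<^esub> x \<in> carrier M"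
    and smult_l_distr:
      "\<lbrakk>a \<in> carrier R; b \<in> carrier R; x \<in> carrier M\<rbrakk> \<Longrightarrow>
       (a \<oplus>\<^bsub>R\<^esub> b) \<odot>\<^bsub>M\<^esub> x = a \<odot>\<^bsub>M\<^esub> x \<oplus>\<^bsub>M\<^esub> b \<odot>\<^bsub>M\<^esub> x"
    and smult_r_distr:
      "\<lbrakk>a \<in> carrier R; x \<in> carrier M; y \<in> carrier M\<rbrakk> \<Longrightarrow>
       a \<odot>\<^bsub>M\<^esub> (x \<oplus>\<^bsub>M\<^esub> y) = a \<odot>\<^bsub>M\<^esub> x \<oplus>\<^bsub>M\<^esub> a \<odot>\<^bsub>M\<^esub> y"
    and smult_assoc:
      "\<lbrakk>a \<in> carrier R; b \<in> carrier R; x \<in> carrier M\<rbrakk> \<Longrightarrow>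
       (a \<otimes>\<^bsub>R\<^esub> b) \<odot>\<^bsub>M\<^esub> x = b \<odot>\<^bsub>M\<^esub> (a \<odot>\<^bsub>M\<^esub> x)"
    and smult_one [simp]:
      "x \<in> carrier M \<Longrightarrow> \<one>\<^bsub>R\<^esub> \<odot>\<^bsub>M\<^esub> x = x"

text \<open>
  Submodules are those of the library (\<^const>\<open>submodule\<close> itself does not assume commutativity of
  \<open>R\<close>).  A submodule \<open>A\<close> of \<open>M\<close> is regarded as a module in its own right by restricting the carrier.
\<close>

abbreviation sub_mod :: "('r, 'm, 'k) module_scheme \<Rightarrow> 'm set \<Rightarrow> ('r, 'm, 'k) module_scheme"
  where "sub_mod M A \<equiv> M\<lparr>carrier := A\<rparr>"

text \<open>Only the values on the carrier of the domain matter for membership.\<close>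

definition mod_hom ::
  "('r, 'a) ring_scheme \<Rightarrow> ('r, 'm, 'k) module_scheme \<Rightarrow> ('r, 'n, 'l) module_scheme \<Rightarrow> ('m \<Rightarrow> 'n) set"
  where "mod_hom R M N =
    {f \<in> carrier M \<rightarrow> carrier N.
       (\<forall>x\<in>carrier M. \<forall>y\<in>carrier M. f (x \<oplus>\<^bsub>M\<^esub> y) = f x \<oplus>\<^bsub>N\<^esub> f y) \<and>
       (\<forall>a\<in>carrier R. \<forall>x\<in>carrier M. f (a \<odot>\<^bsub>M\<^esub> x) = a \<odot>\<^bsub>N\<^esub> f x)}"

definition mod_iso ::
  "('r, 'a) ring_scheme \<Rightarrow> ('r, 'm, 'k) module_scheme \<Rightarrow> ('r, 'n, 'l) module_scheme \<Rightarrow> ('m \<Rightarrow> 'n) set"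
  where "mod_iso R M N = {f \<in> mod_hom R M N. bij_betw f (carrier M) (carrier N)}"

definition mod_isomorphic ::
  "('r, 'a) ring_scheme \<Rightarrow> ('r, 'm, 'k) module_scheme \<Rightarrow> ('r, 'n, 'l) module_scheme \<Rightarrow> bool"
  where "mod_isomorphic R M N \<longleftrightarrow> mod_iso R M N \<noteq> {}"

definition mod_direct_sum ::
  "('r, 'a) ring_scheme \<Rightarrow> ('r, 'm, 'k) module_scheme \<Rightarrow> 'm set \<Rightarrow> 'm set \<Rightarrow> bool"
  where "mod_direct_sum R M A B \<longleftrightarrow>
    submodule A R M \<and> submodule B R M \<and> A <+>\<^bsub>M\<^esub> B = carrier M \<and> A \<inter> B = {\<zero>\<^bsub>M\<^esub>}"

definition weakly_perspective ::
  "('r, 'a) ring_scheme \<Rightarrow> ('r, 'm, 'k) module_scheme \<Rightarrow> bool"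
  where "weakly_perspective R M \<longleftrightarrow>
    (\<forall>A A1 B B1.
       mod_direct_sum R M A A1 \<and> mod_direct_sum R M B B1 \<and>
       mod_isomorphic R (sub_mod M A) (sub_mod M B) \<and>
       mod_isomorphic R (sub_mod M A1) (sub_mod M B1) \<longrightarrow>
       (\<exists>C. mod_direct_sum R M A C \<and> mod_direct_sum R M B C))"

definition is_splitting ::
  "('r, 'a) ring_scheme \<Rightarrow> ('r, 'm, 'k) module_scheme \<Rightarrow> ('r, 'n, 'l) module_scheme \<Rightarrow>
   ('m \<Rightarrow> 'n) \<Rightarrow> ('n \<Rightarrow> 'm) \<Rightarrow> bool"
  where "is_splitting R M N \<phi> \<psi> \<longleftrightarrow>
    \<psi> \<in> mod_hom R N M \<and> (\<forall>y\<in>carrier N. \<phi> (\<psi> y) = y)"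

definition split_epi ::
  "('r, 'a) ring_scheme \<Rightarrow> ('r, 'm, 'k) module_scheme \<Rightarrow> ('r, 'n, 'l) module_scheme \<Rightarrow>
   ('m \<Rightarrow> 'n) \<Rightarrow> bool"
  where "split_epi R M N \<phi> \<longleftrightarrow>
    \<phi> \<in> mod_hom R M N \<and> \<phi> ` carrier M = carrier N \<and> (\<exists>\<psi>. is_splitting R M N \<phi> \<psi>)"

text \<open>
  Endomorphisms are normalised to be \<^const>\<open>undefined\<close> outside the carrier, so that equality in
  the ring is equality of maps on \<open>M\<close>. They act on the left: the product \<open>f g\<close> is \<open>x \<mapsto> f (g x)\<close>.
\<close>

definition End_ring ::
  "('r, 'a) ring_scheme \<Rightarrow> ('r, 'm, 'k) module_scheme \<Rightarrow> ('m \<Rightarrow> 'm) ring"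
  where "End_ring R M =
    \<lparr>carrier = mod_hom R M M \<inter> extensional (carrier M),
     monoid.mult = compose (carrier M),
     one = (\<lambda>x\<in>carrier M. x),
     zero = (\<lambda>x\<in>carrier M. \<zero>\<^bsub>M\<^esub>),
     add = (\<lambda>f g. \<lambda>x\<in>carrier M. f x \<oplus>\<^bsub>M\<^esub> g x)\<rparr>"

definition idempotent_of :: "('s, 'k) ring_scheme \<Rightarrow> 's \<Rightarrow> bool"
  where "idempotent_of S e \<longleftrightarrow> e \<in> carrier S \<and> e \<otimes>\<^bsub>S\<^esub> e = e"

definition corner_ring :: "('s, 'k) ring_scheme \<Rightarrow> 's \<Rightarrow> ('s, 'k) ring_scheme"
  where "corner_ring S e = S\<lparr>carrier := {e \<otimes>\<^bsub>S\<^esub> s \<otimes>\<^bsub>S\<^esub> e | s. s \<in> carrier S}, one := e\<rparr>"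

context right_module
begin

lemma smult_zero:
  assumes "a \<in> carrier R"
  shows "a \<odot>\<^bsub>M\<^esub> \<zero>\<^bsub>M\<^esub> = \<zero>\<^bsub>M\<^esub>"
proof -
  have "a \<odot>\<^bsub>M\<^esub> \<zero>\<^bsub>M\<^esub> \<oplus>\<^bsub>M\<^esub> a \<odot>\<^bsub>M\<^esub> \<zero>\<^bsub>M\<^esub> = a \<odot>\<^bsub>M\<^esub> \<zero>\<^bsub>M\<^esub>"
    using smult_r_distr[OF assms, of "\<zero>\<^bsub>M\<^esub>" "\<zero>\<^bsub>M\<^esub>"] by simp
  then show ?thesis
    using assms M.add.l_cancel_one' [of "a \<odot>\<^bsub>M\<^esub> \<zero>\<^bsub>M\<^esub>" "a \<odot>\<^bsub>M\<^esub> \<zero>\<^bsub>M\<^esub>"] by auto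
qed

lemma smult_minus:
  assumes "a \<in> carrier R" "x \<in> carrier M"
  shows "a \<odot>\<^bsub>M\<^esub> (\<ominus>\<^bsub>M\<^esub> x) = \<ominus>\<^bsub>M\<^esub> (a \<odot>\<^bsub>M\<^esub> x)"
proof -
  have "a \<odot>\<^bsub>M\<^esub> (\<ominus>\<^bsub>M\<^esub> x) \<oplus>\<^bsub>M\<^esub> a \<odot>\<^bsub>M\<^esub> x = \<zero>\<^bsub>M\<^esub>"
    using assms smult_r_distr[of a "\<ominus>\<^bsub>M\<^esub> x" x] by (simp add: M.l_neg smult_zero)
  then show ?thesis
    using assms by (simp add: M.minus_equality)
qed

lemma End_ring_neg:
  assumes f: "f \<in> carrier (End_ring R M)"
  defines "g \<equiv> \<lambda>x\<in>carrier M. \<ominus>\<^bsub>M\<^esub> f x"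
  shows "g \<in> carrier (End_ring R M)" "g \<oplus>\<^bsub>End_ring R M\<^esub> f = \<zero>\<^bsub>End_ring R M\<^esub>"
  using assms
  by (auto simp: End_ring_def mod_hom_def Pi_def M.minus_add smult_minus M.l_neg fun_eq_iff)

lemma End_ring_ring: "ring (End_ring R M)"
proof (rule ringI)
  show "abelian_group (End_ring R M)"
  proof (rule abelian_groupI)
    show "\<exists>g\<in>carrier (End_ring R M). g \<oplus>\<^bsub>End_ring R M\<^esub> f = \<zero>\<^bsub>End_ring R M\<^esub>"
      if "f \<in> carrier (End_ring R M)" for f
      using End_ring_neg[OF that] by blast
  qed (auto simp: End_ring_def mod_hom_def Pi_def extensional_def fun_eq_iff smult_zero
        smult_r_distr M.a_ac)
  show "Group.monoid (End_ring R M)"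
    by (rule monoidI)
      (auto simp: End_ring_def mod_hom_def Pi_def extensional_def compose_def fun_eq_iff)
qed (auto simp: End_ring_def mod_hom_def Pi_def compose_def fun_eq_iff)

lemma End_ring_minus:
  assumes "f \<in> carrier (End_ring R M)" "g \<in> carrier (End_ring R M)" "x \<in> carrier M"
  shows "(f \<ominus>\<^bsub>End_ring R M\<^esub> g) x = f x \<ominus>\<^bsub>M\<^esub> g x"
proof -
  interpret S: ring "End_ring R M" by (rule End_ring_ring)
  have "\<ominus>\<^bsub>End_ring R M\<^esub> g = (\<lambda>x\<in>carrier M. \<ominus>\<^bsub>M\<^esub> g x)"
    using S.minus_equality[OF End_ring_neg(2)[OF assms(2)] assms(2) End_ring_neg(1)[OF assms(2)]] .
  then show ?thesis
    using assms by (simp add: a_minus_def End_ring_def)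
qed

end

lemma (in ring) corner_ring_ring:
  assumes "idempotent_of R e"
  shows "ring (corner_ring R e)"
proof -
  have e: "e \<in> carrier R" "e \<otimes> e = e"
    using assms by (auto simp: idempotent_of_def)
  have ee: "e \<otimes> (e \<otimes> x) = e \<otimes> x" if "x \<in> carrier R" for x
    using e that by (metis m_assoc)
  have car: "x \<in> carrier (corner_ring R e) \<longleftrightarrow> x \<in> carrier R \<and> e \<otimes> x = x \<and> x \<otimes> e = x" for x
  proof
    assume "x \<in> carrier (corner_ring R e)"
    then show "x \<in> carrier R \<and> e \<otimes> x = x \<and> x \<otimes> e = x"
      using e by (auto simp: corner_ring_def m_assoc ee)
  next
    assume "x \<in> carrier R \<and> e \<otimes> x = x \<and> x \<otimes> e = x"
    then show "x \<in> carrier (corner_ring R e)"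
      by (auto simp: corner_ring_def intro!: exI[of _ x])
  qed
  have ops: "\<zero>\<^bsub>corner_ring R e\<^esub> = \<zero>" "\<one>\<^bsub>corner_ring R e\<^esub> = e"
    "x \<oplus>\<^bsub>corner_ring R e\<^esub> y = x \<oplus> y" "x \<otimes>\<^bsub>corner_ring R e\<^esub> y = x \<otimes> y" for x y
    by (simp_all add: corner_ring_def)
  show ?thesis
  proof (rule ringI)
    show "abelian_group (corner_ring R e)"
    proof (rule abelian_groupI)
      show "\<exists>y\<in>carrier (corner_ring R e). y \<oplus>\<^bsub>corner_ring R e\<^esub> x = \<zero>\<^bsub>corner_ring R e\<^esub>"
        if "x \<in> carrier (corner_ring R e)" for x
        using that e by (intro bexI[of _ "\<ominus> x"]) (auto simp: car ops l_neg r_minus l_minus)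
    qed (use e in \<open>auto simp: car ops r_distr l_distr a_ac\<close>)
    show "Group.monoid (corner_ring R e)"
      by (rule monoidI) (use e in \<open>auto simp: car ops m_assoc, metis m_assoc\<close>)
  qed (auto simp: car ops l_distr r_distr)
qed

end

theory Submission
  imports Defs
begin

text \<open>
  Let \<open>\<phi> : M \<rightarrow> N\<close> be surjective and \<open>\<psi> : L \<rightarrow> M\<close> injective. Then \<open>\<phi>\<psi>\<close> is bijective if and only if
  \<open>M = Im \<psi> \<oplus> Ker \<phi>\<close>. For \<open>\<phi> = e\<close> this is the equivalence of (2) and (3), with the same splitting \<open>\<psi>\<close>;
  for \<open>L\<close> a submodule of \<open>M\<close> it says that the images of the splittings of \<open>\<phi>\<close> are exactly the
  complements of \<open>Ker \<phi>\<close>. Thus a common complement of \<open>Ker \<phi>\<close> and \<open>(1 - e)M\<close> is the same thing as a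
  splitting as in (2), and every pair of summands as in the definition of weak perspectivity arises
  in the form \<open>Ker \<phi>\<close>, \<open>(1 - e)M\<close>. Finally, the split epimorphisms \<open>M \<rightarrow> eM\<close> with kernel isomorphic
  to \<open>(1 - e)M\<close> are the maps \<open>eu\<close> with \<open>u\<close> a unit: an isomorphism \<open>Ker \<phi> \<cong> (1 - e)M\<close> together with
  \<open>\<phi>\<close> on a complement gives \<open>u\<close>. Splittings of \<open>eu\<close> correspond to the elements \<open>t\<close> in (4).
\<close>

section \<open>Module homomorphisms and isomorphisms\<close>

lemma (in abelian_group) minus_eq_zero_imp_eq:
  assumes "x \<ominus> y = \<zero>" "x \<in> carrier G" "y \<in> carrier G"
  shows "x = y"
  using assms minus_equality[of x "\<ominus> y"] by (simp add: a_minus_def)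

lemma mem_a_kernel_iff: "x \<in> a_kernel M N f \<longleftrightarrow> x \<in> carrier M \<and> f x = \<zero>\<^bsub>N\<^esub>"
  by (simp add: a_kernel_def kernel_def)

lemma mod_homI:
  assumes "\<And>x. x \<in> carrier M \<Longrightarrow> f x \<in> carrier N"
    and "\<And>x y. \<lbrakk>x \<in> carrier M; y \<in> carrier M\<rbrakk> \<Longrightarrow> f (x \<oplus>\<^bsub>M\<^esub> y) = f x \<oplus>\<^bsub>N\<^esub> f y"
    and "\<And>a x. \<lbrakk>a \<in> carrier R; x \<in> carrier M\<rbrakk> \<Longrightarrow> f (a \<odot>\<^bsub>M\<^esub> x) = a \<odot>\<^bsub>N\<^esub> f x"
  shows "f \<in> mod_hom R M N"
  using assms by (simp add: mod_hom_def)

lemma mod_homD: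
  assumes "f \<in> mod_hom R M N"
  shows "x \<in> carrier M \<Longrightarrow> f x \<in> carrier N"
    and "\<lbrakk>x \<in> carrier M; y \<in> carrier M\<rbrakk> \<Longrightarrow> f (x \<oplus>\<^bsub>M\<^esub> y) = f x \<oplus>\<^bsub>N\<^esub> f y"
    and "\<lbrakk>a \<in> carrier R; x \<in> carrier M\<rbrakk> \<Longrightarrow> f (a \<odot>\<^bsub>M\<^esub> x) = a \<odot>\<^bsub>N\<^esub> f x"
  using assms by (auto simp: mod_hom_def)

lemma mod_hom_comp:
  assumes "f \<in> mod_hom R L M" "g \<in> mod_hom R M N"
  shows "g \<circ> f \<in> mod_hom R L N"
  by (rule mod_homI) (simp_all add: mod_homD[OF assms(1)] mod_homD[OF assms(2)])

lemma mod_hom_domain_restrict: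
  assumes "f \<in> mod_hom R M N" "A \<subseteq> carrier M"
  shows "f \<in> mod_hom R (sub_mod M A) N"
  using assms by (auto simp: mod_hom_def subset_iff)

lemma is_splitting_inj_on:
  assumes "is_splitting R M N \<phi> \<psi>"
  shows "inj_on \<psi> (carrier N)"
  using assms by (metis is_splitting_def inj_on_inverseI)

text \<open>All conditions on \<open>f\<close> concern its values at points of
  \<open>carrier M\<close>, which is closed under the operations. This allows passing between an
  extensional endomorphism and a splitting that agrees with it only on \<open>eM\<close>.\<close>

lemma mod_iso_cong:
  assumes "right_module R M" "\<And>x. x \<in> carrier M \<Longrightarrow> f x = g x"
  shows "f \<in> mod_iso R M N \<longleftrightarrow> g \<in> mod_iso R M N"
proof -
  interpret right_module R M by fact
  show ?thesis
    using assms(2) bij_betw_cong[of "carrier M" f g] by (auto simp: mod_iso_def mod_hom_def Pi_def)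
qed

text \<open>Interpreting this locale makes the rules on zero, sums and negatives available for
  module homomorphisms.\<close>

lemma mod_hom_abelian_group_hom:
  assumes "right_module R M" "right_module R N" "f \<in> mod_hom R M N"
  shows "abelian_group_hom M N f"
proof -
  interpret M: right_module R M by fact
  interpret N: right_module R N by fact
  show ?thesis
    by (rule abelian_group_homI)
      (auto simp: group_hom_def group_hom_axioms_def hom_def mod_homD[OF assms(3)]
        M.M.abelian_group_axioms N.M.abelian_group_axioms M.M.a_group N.M.a_group)
qed

context right_module
begin

section \<open>Submodules, images, kernels and inverse isomorphisms\<close>

text \<open>Closure under negation follows from closure under scalars, since \<open>-x\<close> is
  the multiple of \<open>x\<close> by \<open>-1\<close>.\<close>

lemma submoduleI:
  assumes "A \<subseteq> carrier M" "\<zero>\<^bsub>M\<^esub> \<in> A"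
    and "\<And>x y. \<lbrakk>x \<in> A; y \<in> A\<rbrakk> \<Longrightarrow> x \<oplus>\<^bsub>M\<^esub> y \<in> A"
    and "\<And>a x. \<lbrakk>a \<in> carrier R; x \<in> A\<rbrakk> \<Longrightarrow> a \<odot>\<^bsub>M\<^esub> x \<in> A"
  shows "submodule A R M"
proof -
  have neg: "\<ominus>\<^bsub>M\<^esub> x \<in> A" if "x \<in> A" for x
  proof -
    have x: "x \<in> carrier M" using that assms(1) by blast
    have "(\<ominus>\<^bsub>R\<^esub> \<one>\<^bsub>R\<^esub>) \<odot>\<^bsub>M\<^esub> x \<oplus>\<^bsub>M\<^esub> x = (\<ominus>\<^bsub>R\<^esub> \<one>\<^bsub>R\<^esub> \<oplus>\<^bsub>R\<^esub> \<one>\<^bsub>R\<^esub>) \<odot>\<^bsub>M\<^esub> x"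
      using x by (subst smult_l_distr) auto
    also have "\<dots> = \<zero>\<^bsub>M\<^esub>"
    proof -
      have "\<zero>\<^bsub>R\<^esub> \<odot>\<^bsub>M\<^esub> x \<oplus>\<^bsub>M\<^esub> \<zero>\<^bsub>R\<^esub> \<odot>\<^bsub>M\<^esub> x = \<zero>\<^bsub>R\<^esub> \<odot>\<^bsub>M\<^esub> x"
        using smult_l_distr[of "\<zero>\<^bsub>R\<^esub>" "\<zero>\<^bsub>R\<^esub>" x] x by simp
      then show ?thesis
        using x M.add.l_cancel_one'[of "\<zero>\<^bsub>R\<^esub> \<odot>\<^bsub>M\<^esub> x" "\<zero>\<^bsub>R\<^esub> \<odot>\<^bsub>M\<^esub> x"]
        by (auto simp: R.l_neg)
    qed
    finally have "\<ominus>\<^bsub>M\<^esub> x = (\<ominus>\<^bsub>R\<^esub> \<one>\<^bsub>R\<^esub>) \<odot>\<^bsub>M\<^esub> x"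
      using x by (simp add: M.minus_equality)
    then show ?thesis using assms(4) that by simp
  qed
  show ?thesis
    using assms neg
    by (simp add: submodule_def subgroup_def submodule_axioms_def a_inv_def)
qed

lemma submoduleD:
  assumes "submodule A R M"
  shows "A \<subseteq> carrier M" "x \<in> A \<Longrightarrow> x \<in> carrier M" "\<zero>\<^bsub>M\<^esub> \<in> A"
    and "\<lbrakk>x \<in> A; y \<in> A\<rbrakk> \<Longrightarrow> x \<oplus>\<^bsub>M\<^esub> y \<in> A"
    and "\<lbrakk>a \<in> carrier R; x \<in> A\<rbrakk> \<Longrightarrow> a \<odot>\<^bsub>M\<^esub> x \<in> A"
    and "x \<in> A \<Longrightarrow> \<ominus>\<^bsub>M\<^esub> x \<in> A"
    and "\<lbrakk>x \<in> A; y \<in> A\<rbrakk> \<Longrightarrow> x \<ominus>\<^bsub>M\<^esub> y \<in> A"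
  using assms
  by (auto simp: submodule_def subgroup_def submodule_axioms_def a_inv_def a_minus_def)

lemma right_module_sub_mod:
  assumes "submodule A R M"
  shows "right_module R (sub_mod M A)"
proof -
  note D = submoduleD[OF assms]
  have "abelian_group (sub_mod M A)"
  proof (rule abelian_groupI)
    show "\<exists>y\<in>carrier (sub_mod M A). y \<oplus>\<^bsub>sub_mod M A\<^esub> x = \<zero>\<^bsub>sub_mod M A\<^esub>"
      if "x \<in> carrier (sub_mod M A)" for x
      using that D by (intro bexI[of _ "\<ominus>\<^bsub>M\<^esub> x"]) (auto simp: M.l_neg)
  qed (auto simp: D M.a_ac)
  then show ?thesis
    by (intro right_module.intro R.ring_axioms right_module_axioms.intro)
      (auto simp: D smult_l_distr smult_r_distr smult_assoc)
qed

lemma mod_hom_sub_mod: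
  assumes "f \<in> mod_hom R L (sub_mod M A)" "submodule A R M"
  shows "f \<in> mod_hom R L M"
  by (rule mod_homI) (use mod_homD[OF assms(1)] submoduleD[OF assms(2)] in auto)

lemma submodule_image:
  assumes "right_module R L" "f \<in> mod_hom R L M"
  shows "submodule (f ` carrier L) R M"
proof -
  interpret L: right_module R L by fact
  interpret f: abelian_group_hom L M f
    by (rule mod_hom_abelian_group_hom) (use assms right_module_axioms in auto)
  show ?thesis
  proof (rule submoduleI)
    show "\<zero>\<^bsub>M\<^esub> \<in> f ` carrier L"
      using f.hom_zero by (metis L.M.zero_closed imageI)
    show "x \<oplus>\<^bsub>M\<^esub> y \<in> f ` carrier L" if "x \<in> f ` carrier L" "y \<in> f ` carrier L" for x y
      using that by (metis (no_types, lifting) L.M.add.m_closed f.hom_add image_iff)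
    show "a \<odot>\<^bsub>M\<^esub> x \<in> f ` carrier L" if "a \<in> carrier R" "x \<in> f ` carrier L" for a x
      using that by (metis (no_types, lifting) L.smult_closed mod_homD(3)[OF assms(2)] image_iff)
  qed auto
qed

lemma submodule_a_kernel:
  assumes "right_module R N" "f \<in> mod_hom R M N"
  shows "submodule (a_kernel M N f) R M"
proof -
  interpret N: right_module R N by fact
  interpret f: abelian_group_hom M N f
    by (rule mod_hom_abelian_group_hom) (use assms right_module_axioms in auto)
  show ?thesis
    by (rule submoduleI) (auto simp: mem_a_kernel_iff mod_homD(3)[OF assms(2)] N.smult_zero)
qed

lemma mod_iso_inv_into:
  assumes "f \<in> mod_iso R M N"
  shows "inv_into (carrier M) f \<in> mod_iso R N M"
proof -
  let ?g = "inv_into (carrier M) f"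
  have f: "f \<in> mod_hom R M N" and bij: "bij_betw f (carrier M) (carrier N)"
    using assms by (auto simp: mod_iso_def)
  have g: "?g y \<in> carrier M" "f (?g y) = y" if "y \<in> carrier N" for y
    using that bij by (auto simp: bij_betw_def inv_into_into f_inv_into_f)
  have gf: "?g (f x) = x" if "x \<in> carrier M" for x
    using that bij by (simp add: bij_betw_inv_into_left)
  have "?g \<in> mod_hom R N M"
  proof (rule mod_homI)
    \<comment> \<open>Both sides have the same image under \<open>f\<close>; cancelling
      \<open>f\<close> with \<open>gf\<close> yields the equation.\<close>
    show "?g (x \<oplus>\<^bsub>N\<^esub> y) = ?g x \<oplus>\<^bsub>M\<^esub> ?g y" if "x \<in> carrier N" "y \<in> carrier N" for x y
      using gf[of "?g x \<oplus>\<^bsub>M\<^esub> ?g y"] g that by (simp add: mod_homD(2)[OF f])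
    show "?g (a \<odot>\<^bsub>N\<^esub> x) = a \<odot>\<^bsub>M\<^esub> ?g x" if "a \<in> carrier R" "x \<in> carrier N" for a x
      using gf[of "a \<odot>\<^bsub>M\<^esub> ?g x"] g that by (simp add: mod_homD(3)[OF f])
  qed (use g in auto)
  then show ?thesis
    using bij by (simp add: mod_iso_def bij_betw_inv_into)
qed

section \<open>Internal direct sums\<close>

text \<open>The elementwise form in which direct sums are built and taken apart below. Zero lies in
  both submodules and sums stay in the carrier, so one inclusion of each set equation
  suffices.\<close>

lemma mod_direct_sum_iff:
  "mod_direct_sum R M A B \<longleftrightarrow> submodule A R M \<and> submodule B R M \<and>
     (\<forall>x\<in>carrier M. \<exists>a\<in>A. \<exists>b\<in>B. x = a \<oplus>\<^bsub>M\<^esub> b) \<and> (\<forall>x\<in>A \<inter> B. x = \<zero>\<^bsub>M\<^esub>)"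
  (is "?l \<longleftrightarrow> ?r")
proof (cases "submodule A R M \<and> submodule B R M")
  case True
  then have "a \<in> A \<Longrightarrow> b \<in> B \<Longrightarrow> a \<oplus>\<^bsub>M\<^esub> b \<in> carrier M" for a b
    using submoduleD(2) by blast
  moreover have "\<zero>\<^bsub>M\<^esub> \<in> A \<inter> B"
    using True submoduleD(3) by blast
  ultimately show ?thesis
    using True unfolding mod_direct_sum_def set_add_def' by blast
qed (auto simp: mod_direct_sum_def)

lemma mod_direct_sum_commute:
  assumes "mod_direct_sum R M A B"
  shows "mod_direct_sum R M B A"
  using assms submoduleD(2) M.a_comm unfolding mod_direct_sum_iff by (metis Int_commute)

text \<open>Surjectivity of \<open>\<phi> \<circ> \<psi>\<close> corresponds to the sum being all of
  \<open>M\<close>, injectivity to the trivial intersection. The lemma is applied to splittings, to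
  the idempotent \<open>e\<close> in place of \<open>\<phi>\<close>, and to inclusions of submodules
  in place of \<open>\<psi>\<close>.\<close>

lemma bij_betw_comp_iff_direct_sum:
  assumes L: "right_module R L" and N: "right_module R N"
    and \<psi>: "\<psi> \<in> mod_hom R L M" and inj: "inj_on \<psi> (carrier L)"
    and \<phi>: "\<phi> \<in> mod_hom R M N" and surj: "\<phi> ` carrier M = carrier N"
  shows "bij_betw (\<phi> \<circ> \<psi>) (carrier L) (carrier N) \<longleftrightarrow>
    mod_direct_sum R M (\<psi> ` carrier L) (a_kernel M N \<phi>)"
proof -
  interpret L: right_module R L by fact
  interpret N: right_module R N by fact
  interpret \<psi>: abelian_group_hom L M \<psi>
    by (rule mod_hom_abelian_group_hom) (use assms right_module_axioms in auto)
  interpret \<phi>: abelian_group_hom M N \<phi>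
    by (rule mod_hom_abelian_group_hom) (use assms right_module_axioms in auto)
  have sub: "submodule (\<psi> ` carrier L) R M" "submodule (a_kernel M N \<phi>) R M"
    using submodule_image[OF L \<psi>] submodule_a_kernel[OF N \<phi>] by auto
  show ?thesis
  proof
    assume bij: "bij_betw (\<phi> \<circ> \<psi>) (carrier L) (carrier N)"
    have "\<exists>a\<in>\<psi> ` carrier L. \<exists>b\<in>a_kernel M N \<phi>. x = a \<oplus>\<^bsub>M\<^esub> b" if x: "x \<in> carrier M" for x
    proof -
      have "\<phi> x \<in> (\<phi> \<circ> \<psi>) ` carrier L"
        using \<phi>.hom_closed[OF x] by (simp only: bij_betw_imp_surj_on[OF bij])
      then obtain l where l: "l \<in> carrier L" "\<phi> (\<psi> l) = \<phi> x"
        by (elim imageE) simp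
      \<comment> \<open>Subtracting an element of the image with the same value under
        \<open>\<phi>\<close> leaves the kernel component of \<open>x\<close>.\<close>
      have "x \<ominus>\<^bsub>M\<^esub> \<psi> l \<in> a_kernel M N \<phi>"
        using l x by (simp add: mem_a_kernel_iff a_minus_def N.M.r_neg)
      moreover have "x = \<psi> l \<oplus>\<^bsub>M\<^esub> (x \<ominus>\<^bsub>M\<^esub> \<psi> l)"
        using l x by (simp add: a_minus_def M.a_lcomm M.r_neg)
      ultimately show ?thesis using l by blast
    qed
    moreover have "x = \<zero>\<^bsub>M\<^esub>" if "x \<in> \<psi> ` carrier L \<inter> a_kernel M N \<phi>" for x
    proof -
      from that obtain l where l: "l \<in> carrier L" "x = \<psi> l" by (elim IntE imageE)
      moreover from this have "\<phi> (\<psi> l) = \<zero>\<^bsub>N\<^esub>"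
        using IntD2[OF that] by (simp only: mem_a_kernel_iff)
      \<comment> \<open>The composite takes the same value at \<open>l\<close> and at zero, so its
        injectivity applies.\<close>
      moreover have "\<phi> (\<psi> \<zero>\<^bsub>L\<^esub>) = \<zero>\<^bsub>N\<^esub>" by simp
      ultimately have "l = \<zero>\<^bsub>L\<^esub>"
        using bij L.M.zero_closed unfolding bij_betw_def inj_on_def by auto
      then show ?thesis using l by simp
    qed
    ultimately show "mod_direct_sum R M (\<psi> ` carrier L) (a_kernel M N \<phi>)"
      using sub by (simp add: mod_direct_sum_iff)
  next
    assume ds: "mod_direct_sum R M (\<psi> ` carrier L) (a_kernel M N \<phi>)"
    show "bij_betw (\<phi> \<circ> \<psi>) (carrier L) (carrier N)"
    proof (rule bij_betw_imageI)
      show "inj_on (\<phi> \<circ> \<psi>) (carrier L)"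
      proof (rule inj_onI)
        fix k l assume kl: "k \<in> carrier L" "l \<in> carrier L" "(\<phi> \<circ> \<psi>) k = (\<phi> \<circ> \<psi>) l"
        then have "\<psi> (k \<ominus>\<^bsub>L\<^esub> l) \<in> a_kernel M N \<phi>"
          by (simp add: mem_a_kernel_iff a_minus_def N.M.r_neg)
        then have "\<psi> (k \<ominus>\<^bsub>L\<^esub> l) = \<psi> \<zero>\<^bsub>L\<^esub>"
          using ds kl by (simp add: mod_direct_sum_iff)
        then have "k \<ominus>\<^bsub>L\<^esub> l = \<zero>\<^bsub>L\<^esub>"
          by (rule inj_onD[OF inj]) (use kl in simp_all)
        then show "k = l" using kl L.M.minus_eq_zero_imp_eq by blast
      qed
      have "y \<in> (\<phi> \<circ> \<psi>) ` carrier L" if y: "y \<in> carrier N" for y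
      proof -
        obtain x where x: "x \<in> carrier M" "y = \<phi> x"
          using y unfolding surj[symmetric] by (elim imageE)
        then obtain l k where "l \<in> carrier L" "k \<in> a_kernel M N \<phi>" "x = \<psi> l \<oplus>\<^bsub>M\<^esub> k"
          using ds unfolding mod_direct_sum_iff by blast
        then have "y = \<phi> (\<psi> l)" using x by (simp add: mem_a_kernel_iff)
        then show ?thesis using \<open>l \<in> carrier L\<close> by auto
      qed
      then show "(\<phi> \<circ> \<psi>) ` carrier L = carrier N" by auto
    qed
  qed
qed

text \<open>Here \<open>\<phi> \<circ> \<psi>\<close> is the identity of \<open>N\<close>, hence
  bijective, and the criterion above applies.\<close>

lemma splitting_direct_sum:
  assumes "right_module R N" "split_epi R M N \<phi>" "is_splitting R M N \<phi> \<psi>"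
  shows "mod_direct_sum R M (\<psi> ` carrier N) (a_kernel M N \<phi>)"
proof -
  have "bij_betw (\<phi> \<circ> \<psi>) (carrier N) (carrier N)"
    using assms(3) by (intro bij_betw_byWitness[where f' = id]) (auto simp: is_splitting_def)
  then show ?thesis
    using assms is_splitting_inj_on[OF assms(3)] bij_betw_comp_iff_direct_sum[of N N \<psi> \<phi>]
    by (auto simp: split_epi_def is_splitting_def)
qed

section \<open>Endomorphisms, units and idempotents\<close>

lemma End_ring_eqI:
  assumes "f \<in> carrier (End_ring R M)" "g \<in> carrier (End_ring R M)"
    and "\<And>x. x \<in> carrier M \<Longrightarrow> f x = g x"
  shows "f = g"
  using assms by (auto simp: End_ring_def intro: extensionalityI)

lemma End_ring_mult_apply [simp]:
  "x \<in> carrier M \<Longrightarrow> (f \<otimes>\<^bsub>End_ring R M\<^esub> g) x = f (g x)"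
  by (simp add: End_ring_def compose_def)

lemma End_ring_one_apply [simp]: "x \<in> carrier M \<Longrightarrow> \<one>\<^bsub>End_ring R M\<^esub> x = x"
  by (simp add: End_ring_def)

lemma End_ring_mod_hom: "f \<in> carrier (End_ring R M) \<Longrightarrow> f \<in> mod_hom R M M"
  by (simp add: End_ring_def)

lemma End_ring_closed: "f \<in> carrier (End_ring R M) \<Longrightarrow> x \<in> carrier M \<Longrightarrow> f x \<in> carrier M"
  using mod_homD(1)[OF End_ring_mod_hom] .

lemma restrict_in_End_ring:
  assumes "f \<in> mod_hom R M M"
  shows "restrict f (carrier M) \<in> carrier (End_ring R M)"
  using assms by (auto simp: End_ring_def mod_hom_def Pi_def)

text \<open>The set-theoretic inverse of a bijective endomorphism is again linear; restricting it to
  the carrier makes it an element of the endomorphism ring.\<close>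

lemma End_ring_Units_iff:
  "u \<in> Units (End_ring R M) \<longleftrightarrow> u \<in> carrier (End_ring R M) \<and> bij_betw u (carrier M) (carrier M)"
proof
  assume "u \<in> Units (End_ring R M)"
  then obtain v where u: "u \<in> carrier (End_ring R M)" and v: "v \<in> carrier (End_ring R M)"
    and uv: "u \<otimes>\<^bsub>End_ring R M\<^esub> v = \<one>\<^bsub>End_ring R M\<^esub>" "v \<otimes>\<^bsub>End_ring R M\<^esub> u = \<one>\<^bsub>End_ring R M\<^esub>"
    by (auto simp: Units_def)
  have "u (v x) = x" "v (u x) = x" if "x \<in> carrier M" for x
    using that fun_cong[OF uv(1), of x] fun_cong[OF uv(2), of x] by auto
  then have "bij_betw u (carrier M) (carrier M)"
    using u v by (intro bij_betw_byWitness[where f' = v]) (auto intro: End_ring_closed)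
  then show "u \<in> carrier (End_ring R M) \<and> bij_betw u (carrier M) (carrier M)"
    using u by simp
next
  interpret S: ring "End_ring R M" by (rule End_ring_ring)
  assume u: "u \<in> carrier (End_ring R M) \<and> bij_betw u (carrier M) (carrier M)"
  then have "inv_into (carrier M) u \<in> mod_iso R M M"
    by (intro mod_iso_inv_into) (simp add: mod_iso_def End_ring_mod_hom)
  then have v: "restrict (inv_into (carrier M) u) (carrier M) \<in> carrier (End_ring R M)"
    (is "?v \<in> _") by (simp add: mod_iso_def restrict_in_End_ring)
  have "?v (u x) = x" "u (?v x) = x" if "x \<in> carrier M" for x
    using that u End_ring_closed[of u x]
    by (auto simp: bij_betw_inv_into_left bij_betw_inv_into_right)
  then have "?v \<otimes>\<^bsub>End_ring R M\<^esub> u = \<one>\<^bsub>End_ring R M\<^esub>" "u \<otimes>\<^bsub>End_ring R M\<^esub> ?v = \<one>\<^bsub>End_ring R M\<^esub>"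
    using u v by (auto intro!: End_ring_eqI)
  then show "u \<in> Units (End_ring R M)"
    using u v unfolding Units_def by blast
qed

text \<open>Collects what makes \<open>eM\<close> usable as a module: \<open>e\<close> fixes it
  pointwise and maps \<open>M\<close> into it.\<close>

lemma idempotent_ofD:
  assumes "idempotent_of (End_ring R M) e"
  shows "e \<in> carrier (End_ring R M)"
    and "x \<in> carrier M \<Longrightarrow> e (e x) = e x"
    and "submodule (e ` carrier M) R M"
    and "x \<in> e ` carrier M \<Longrightarrow> x \<in> carrier M"
    and "x \<in> e ` carrier M \<Longrightarrow> e x = x"
    and "e \<in> mod_hom R M (sub_mod M (e ` carrier M))"
    and "right_module R (sub_mod M (e ` carrier M))"
proof -
  show e: "e \<in> carrier (End_ring R M)"
    using assms by (simp add: idempotent_of_def)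
  have ee: "e (e x) = e x" if "x \<in> carrier M" for x
    using assms that End_ring_mult_apply[of x e e] by (simp add: idempotent_of_def)
  then show "x \<in> carrier M \<Longrightarrow> e (e x) = e x" .
  show "x \<in> e ` carrier M \<Longrightarrow> e x = x"
    using ee by auto
  show sub: "submodule (e ` carrier M) R M"
    by (rule submodule_image) (use e End_ring_mod_hom right_module_axioms in auto)
  show "x \<in> e ` carrier M \<Longrightarrow> x \<in> carrier M"
    using submoduleD(2)[OF sub] .
  show "e \<in> mod_hom R M (sub_mod M (e ` carrier M))"
    using End_ring_mod_hom[OF e] by (auto simp: mod_hom_def)
  show "right_module R (sub_mod M (e ` carrier M))"
    using right_module_sub_mod[OF sub] .
qed

text \<open>From \<open>e(x - ex) = 0\<close> comes one inclusion; conversely \<open>ex = 0\<close>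
  gives \<open>x = (1 - e)x\<close>. The kernel is taken with codomain \<open>eM\<close> so that the
  criterion for direct sums applies to \<open>e\<close> as a surjection onto
  \<open>eM\<close>.\<close>

lemma idempotent_complement_image:
  assumes "idempotent_of (End_ring R M) e"
  shows "(\<one>\<^bsub>End_ring R M\<^esub> \<ominus>\<^bsub>End_ring R M\<^esub> e) ` carrier M = a_kernel M (sub_mod M (e ` carrier M)) e"
proof -
  interpret S: ring "End_ring R M" by (rule End_ring_ring)
  note e = idempotent_ofD[OF assms]
  interpret e: abelian_group_hom M M e
    by (rule mod_hom_abelian_group_hom[OF right_module_axioms right_module_axioms End_ring_mod_hom[OF e(1)]])
  have eq: "(\<one>\<^bsub>End_ring R M\<^esub> \<ominus>\<^bsub>End_ring R M\<^esub> e) x = x \<oplus>\<^bsub>M\<^esub> \<ominus>\<^bsub>M\<^esub> e x" if "x \<in> carrier M" for x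
    using that e(1) by (simp add: End_ring_minus M.minus_eq)
  show ?thesis
  proof
    show "(\<one>\<^bsub>End_ring R M\<^esub> \<ominus>\<^bsub>End_ring R M\<^esub> e) ` carrier M \<subseteq> a_kernel M (sub_mod M (e ` carrier M)) e"
      using e(2) by (auto simp: eq mem_a_kernel_iff M.r_neg)
    show "a_kernel M (sub_mod M (e ` carrier M)) e \<subseteq> (\<one>\<^bsub>End_ring R M\<^esub> \<ominus>\<^bsub>End_ring R M\<^esub> e) ` carrier M"
    proof
      fix x assume "x \<in> a_kernel M (sub_mod M (e ` carrier M)) e"
      then have x: "x \<in> carrier M" "e x = \<zero>\<^bsub>M\<^esub>"
        by (auto simp: mem_a_kernel_iff)
      then have "x = (\<one>\<^bsub>End_ring R M\<^esub> \<ominus>\<^bsub>End_ring R M\<^esub> e) x"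
        by (simp add: eq)
      then show "x \<in> (\<one>\<^bsub>End_ring R M\<^esub> \<ominus>\<^bsub>End_ring R M\<^esub> e) ` carrier M"
        using x(1) by (rule image_eqI)
    qed
  qed
qed

text \<open>The inclusion of \<open>eM\<close> into \<open>M\<close> splits \<open>e\<close>,
  because \<open>e\<close> is the identity on its image.\<close>

lemma idempotent_split_epi:
  assumes "idempotent_of (End_ring R M) e"
  shows "split_epi R M (sub_mod M (e ` carrier M)) e"
    and "is_splitting R M (sub_mod M (e ` carrier M)) e id"
proof -
  note e = idempotent_ofD[OF assms]
  show "is_splitting R M (sub_mod M (e ` carrier M)) e id"
    unfolding is_splitting_def
  proof (intro conjI ballI mod_homI)
    fix y assume "y \<in> carrier (sub_mod M (e ` carrier M))"
    then have "y \<in> e ` carrier M" by simp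
    then show "id y \<in> carrier M" "e (id y) = y"
      using e(4,5)[of y] unfolding id_apply by blast+
  qed simp_all
  then show "split_epi R M (sub_mod M (e ` carrier M)) e"
    using e(6) by (auto simp: split_epi_def)
qed

lemma idempotent_direct_sum:
  assumes "idempotent_of (End_ring R M) e"
  shows "mod_direct_sum R M (e ` carrier M) (a_kernel M (sub_mod M (e ` carrier M)) e)"
  using splitting_direct_sum[OF idempotent_ofD(7) idempotent_split_epi] assms by fastforce

text \<open>The idempotent is the projection onto \<open>A\<close> along \<open>B\<close>. It turns
  arbitrary direct decompositions into statements about idempotents.\<close>

lemma direct_sum_projection:
  assumes "mod_direct_sum R M A B"
  obtains e where "idempotent_of (End_ring R M) e" "e ` carrier M = A"
    "a_kernel M (sub_mod M A) e = B"
proof -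
  have A: "submodule A R M" and B: "submodule B R M"
    and ex: "\<And>x. x \<in> carrier M \<Longrightarrow> \<exists>a. a \<in> A \<and> (\<exists>b\<in>B. x = a \<oplus>\<^bsub>M\<^esub> b)"
    and triv: "\<And>x. x \<in> A \<Longrightarrow> x \<in> B \<Longrightarrow> x = \<zero>\<^bsub>M\<^esub>"
    using assms unfolding mod_direct_sum_iff by blast+
  note A = submoduleD[OF A] and B = submoduleD[OF B]
  \<comment> \<open>A choice of first components; uniqueness of decompositions then makes this
    choice linear.\<close>
  obtain p where p: "\<And>x. x \<in> carrier M \<Longrightarrow> p x \<in> A \<and> (\<exists>b\<in>B. x = p x \<oplus>\<^bsub>M\<^esub> b)"
    using ex by metis
  \<comment> \<open>The difference \<open>a - a'\<close> equals \<open>b' - b\<close>, so it lies in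
    both \<open>A\<close> and \<open>B\<close> and vanishes.\<close>
  have uniq: "a = a'" if "a \<in> A" "a' \<in> A" "b \<in> B" "b' \<in> B" "a \<oplus>\<^bsub>M\<^esub> b = a' \<oplus>\<^bsub>M\<^esub> b'" for a a' b b'
  proof -
    have car: "a \<in> carrier M" "a' \<in> carrier M" "b \<in> carrier M" "b' \<in> carrier M"
      using that A(2) B(2) by auto
    have "a \<ominus>\<^bsub>M\<^esub> a' = (a \<ominus>\<^bsub>M\<^esub> a') \<oplus>\<^bsub>M\<^esub> (b \<ominus>\<^bsub>M\<^esub> b)"
      using car by (simp add: M.minus_eq M.r_neg)
    also have "\<dots> = (a \<oplus>\<^bsub>M\<^esub> b) \<oplus>\<^bsub>M\<^esub> (\<ominus>\<^bsub>M\<^esub> a' \<oplus>\<^bsub>M\<^esub> \<ominus>\<^bsub>M\<^esub> b)"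
      using car by (simp add: M.minus_eq M.a_ac)
    also have "\<dots> = (a' \<ominus>\<^bsub>M\<^esub> a') \<oplus>\<^bsub>M\<^esub> (b' \<ominus>\<^bsub>M\<^esub> b)"
      unfolding that(5) using car by (simp add: M.minus_eq M.a_ac)
    also have "\<dots> = b' \<ominus>\<^bsub>M\<^esub> b"
      using car by (simp add: M.minus_eq M.r_neg)
    finally have "a \<ominus>\<^bsub>M\<^esub> a' = \<zero>\<^bsub>M\<^esub>"
      using triv A(7) B(7) that by metis
    then show "a = a'" using car M.minus_eq_zero_imp_eq by blast
  qed
  \<comment> \<open>Any decomposition of an element computes \<open>p\<close>. Additivity and
    linearity of \<open>p\<close> follow by combining decompositions.\<close>
  have p_eq: "p (a \<oplus>\<^bsub>M\<^esub> b) = a" if "a \<in> A" "b \<in> B" for a b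
  proof -
    have "a \<oplus>\<^bsub>M\<^esub> b \<in> carrier M" using that A(2) B(2) by auto
    then show ?thesis using p that uniq by metis
  qed
  have pA: "p a = a" if "a \<in> A" for a
    using p_eq[OF that B(3)] that A(2) by simp
  have pB: "p b = \<zero>\<^bsub>M\<^esub>" if "b \<in> B" for b
    using p_eq[OF A(3) that] that B(2) by simp
  have "p \<in> mod_hom R M M"
  proof (rule mod_homI)
    show "p (x \<oplus>\<^bsub>M\<^esub> y) = p x \<oplus>\<^bsub>M\<^esub> p y" if xy: "x \<in> carrier M" "y \<in> carrier M" for x y
    proof -
      obtain b c where bc: "b \<in> B" "x = p x \<oplus>\<^bsub>M\<^esub> b" "c \<in> B" "y = p y \<oplus>\<^bsub>M\<^esub> c"
        using p[OF xy(1)] p[OF xy(2)] by blast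
      have pxy: "p x \<in> A" "p y \<in> A" using p xy by auto
      have "x \<oplus>\<^bsub>M\<^esub> y = (p x \<oplus>\<^bsub>M\<^esub> b) \<oplus>\<^bsub>M\<^esub> (p y \<oplus>\<^bsub>M\<^esub> c)"
        by (rule arg_cong2[OF bc(2,4)])
      also have "\<dots> = (p x \<oplus>\<^bsub>M\<^esub> p y) \<oplus>\<^bsub>M\<^esub> (b \<oplus>\<^bsub>M\<^esub> c)"
        using pxy[THEN A(2)] bc(1,3)[THEN B(2)] by (simp add: M.a_ac)
      finally show ?thesis
        using p_eq[OF A(4)[OF pxy] B(4)[OF bc(1,3)]] by simp
    qed
    show "p (a \<odot>\<^bsub>M\<^esub> x) = a \<odot>\<^bsub>M\<^esub> p x" if ax: "a \<in> carrier R" "x \<in> carrier M" for a x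
    proof -
      obtain b where b: "b \<in> B" "x = p x \<oplus>\<^bsub>M\<^esub> b" using p[OF ax(2)] by blast
      have px: "p x \<in> A" using p ax by auto
      have "a \<odot>\<^bsub>M\<^esub> x = a \<odot>\<^bsub>M\<^esub> (p x \<oplus>\<^bsub>M\<^esub> b)"
        by (rule arg_cong[OF b(2)])
      also have "\<dots> = a \<odot>\<^bsub>M\<^esub> p x \<oplus>\<^bsub>M\<^esub> a \<odot>\<^bsub>M\<^esub> b"
        using ax(1) A(2)[OF px] B(2)[OF b(1)] by (simp add: smult_r_distr)
      finally show ?thesis
        using p_eq[OF A(5)[OF ax(1) px] B(5)[OF ax(1) b(1)]] by simp
    qed
  qed (use p A(2) in blast)
  then have e: "restrict p (carrier M) \<in> carrier (End_ring R M)" (is "?e \<in> _")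
    by (rule restrict_in_End_ring)
  interpret S: ring "End_ring R M" by (rule End_ring_ring)
  show thesis
  proof
    show "idempotent_of (End_ring R M) ?e"
      using e p pA A(2) by (auto simp: idempotent_of_def intro!: End_ring_eqI)
    show "?e ` carrier M = A"
      using p pA A(2) by force
    have "x \<in> B" if "x \<in> carrier M" "p x = \<zero>\<^bsub>M\<^esub>" for x
      using p[OF that(1)] that(2) B(2) by auto
    then show "a_kernel M (sub_mod M A) ?e = B"
      using pB B(2) by (auto simp: mem_a_kernel_iff)
  qed
qed

section \<open>Units of the corner ring and automorphisms of eM\<close>

text \<open>Restriction to \<open>eM\<close> identifies the corner ring \<open>eSe\<close> with the
  endomorphism ring of \<open>eM\<close>. Since \<open>e\<close> fixes \<open>eM\<close> pointwise,
  \<open>ete\<close> restricts to \<open>e \<circ> t\<close>.\<close>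

lemma corner_ring_Units_iff:
  assumes e: "idempotent_of (End_ring R M) e" and t: "t \<in> carrier (End_ring R M)"
  shows "e \<otimes>\<^bsub>End_ring R M\<^esub> t \<otimes>\<^bsub>End_ring R M\<^esub> e \<in> Units (corner_ring (End_ring R M) e) \<longleftrightarrow>
    e \<circ> t \<in> mod_iso R (sub_mod M (e ` carrier M)) (sub_mod M (e ` carrier M))"
    (is "?a \<in> Units ?C \<longleftrightarrow> _ \<in> mod_iso R ?N ?N")
proof -
  interpret S: ring "End_ring R M" by (rule End_ring_ring)
  note E = idempotent_ofD[OF e]
  have a: "?a \<in> carrier (End_ring R M)" "?a \<in> carrier ?C"
    using E(1) t by (auto simp: corner_ring_def)
  have et: "e \<circ> t \<in> mod_hom R ?N ?N"
  proof (rule mod_hom_comp)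
    show "t \<in> mod_hom R ?N M"
      using mod_hom_domain_restrict[OF End_ring_mod_hom[OF t] submoduleD(1)[OF E(3)]] .
  qed (rule E(6))
  show ?thesis
  proof
    assume "?a \<in> Units ?C"
    then obtain v where v: "v \<in> carrier ?C" "v \<otimes>\<^bsub>End_ring R M\<^esub> ?a = e" "?a \<otimes>\<^bsub>End_ring R M\<^esub> v = e"
      by (auto simp: Units_def corner_ring_def)
    obtain w where w: "w \<in> carrier (End_ring R M)" "v = e \<otimes>\<^bsub>End_ring R M\<^esub> w \<otimes>\<^bsub>End_ring R M\<^esub> e"
      using v(1) by (auto simp: corner_ring_def)
    \<comment> \<open>The inverse in the corner ring has the form \<open>ewe\<close>, so it maps
      \<open>eM\<close> into itself and inverts \<open>e \<circ> t\<close> there.\<close>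
    have "v ((e \<circ> t) x) = x" "(e \<circ> t) (v x) = x" "v x \<in> e ` carrier M" if "x \<in> e ` carrier M" for x
    proof -
      have x: "x \<in> carrier M" "e x = x" using E(4,5)[OF that] by auto
      show "v ((e \<circ> t) x) = x"
        using fun_cong[OF v(2), of x] x by simp
      have "v x = e (w x)"
        using w(2) x by simp
      then show vx: "v x \<in> e ` carrier M"
        using End_ring_closed[OF w(1) x(1)] by simp
      then show "(e \<circ> t) (v x) = x"
        using fun_cong[OF v(3), of x] x E(4,5)[of "v x"] by simp
    qed
    then have "bij_betw (e \<circ> t) (carrier ?N) (carrier ?N)"
      using mod_homD(1)[OF et] by (intro bij_betw_byWitness[where f' = v]) auto
    then show "e \<circ> t \<in> mod_iso R ?N ?N"
      using et by (simp add: mod_iso_def)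
  next
    assume iso: "e \<circ> t \<in> mod_iso R ?N ?N"
    let ?b = "inv_into (carrier ?N) (e \<circ> t)"
    have bij: "bij_betw (e \<circ> t) (carrier ?N) (carrier ?N)"
      using iso by (simp add: mod_iso_def)
    interpret N: right_module R ?N by (rule E(7))
    have b: "?b \<in> mod_hom R ?N ?N"
      using N.mod_iso_inv_into[OF iso] by (simp add: mod_iso_def)
    \<comment> \<open>The inverse automorphism of \<open>eM\<close> is extended to \<open>M\<close>
      by zero on \<open>(1 - e)M\<close>.\<close>
    let ?v = "restrict (?b \<circ> e) (carrier M)"
    have "?b \<circ> e \<in> mod_hom R M M"
      using mod_hom_sub_mod[OF mod_hom_comp[OF E(6) b] E(3)] .
    then have v: "?v \<in> carrier (End_ring R M)"
      by (rule restrict_in_End_ring)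
    have bN: "?b x \<in> e ` carrier M" if "x \<in> e ` carrier M" for x
      using mod_homD(1)[OF b, of x] that by simp
    have vN: "?v x = ?b (e x)" "e (?v x) = ?v x" if "x \<in> carrier M" for x
      using E(5)[OF bN[of "e x"]] that by auto
    \<comment> \<open>Invariance under multiplication by \<open>e\<close> on both sides places the
      extension in the corner ring.\<close>
    have "?v = e \<otimes>\<^bsub>End_ring R M\<^esub> ?v \<otimes>\<^bsub>End_ring R M\<^esub> e"
    proof (rule End_ring_eqI)
      fix x assume x: "x \<in> carrier M"
      show "?v x = (e \<otimes>\<^bsub>End_ring R M\<^esub> ?v \<otimes>\<^bsub>End_ring R M\<^esub> e) x"
        using x vN(2)[of "e x"] E(2)[OF x] End_ring_closed[OF E(1) x] by simp
    qed (use v E(1) in auto)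
    then have vC: "?v \<in> carrier ?C"
      using v unfolding corner_ring_def by auto
    have "?v \<otimes>\<^bsub>End_ring R M\<^esub> ?a = e"
    proof (rule End_ring_eqI)
      fix x assume x: "x \<in> carrier M"
      have "?b (e (t (e x))) = e x"
        using bij_betw_inv_into_left[OF bij, of "e x"] x by simp
      then show "(?v \<otimes>\<^bsub>End_ring R M\<^esub> ?a) x = e x"
        using x End_ring_closed[OF E(1)] End_ring_closed[OF t] E(2) by simp
    qed (use v a E(1) in auto)
    moreover have "?a \<otimes>\<^bsub>End_ring R M\<^esub> ?v = e"
    proof (rule End_ring_eqI)
      fix x assume x: "x \<in> carrier M"
      have "e (t (?b (e x))) = e x"
        using bij_betw_inv_into_right[OF bij, of "e x"] x by simp
      then show "(?a \<otimes>\<^bsub>End_ring R M\<^esub> ?v) x = e x"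
        using x vN[OF x] End_ring_closed[OF v x] by simp
    qed (use v a E(1) in auto)
    ultimately show "?a \<in> Units ?C"
      using a(2) vC by (auto simp: Units_def corner_ring_def)
  qed
qed

text \<open>A splitting is injective, so the criterion for direct sums applies to the pair
  \<open>\<psi>\<close>, \<open>e\<close>, whose relevant kernel is
  \<open>Ker e = (1 - e)M\<close>.\<close>

lemma splitting_complement_iff:
  assumes e: "idempotent_of (End_ring R M) e"
    and \<psi>: "is_splitting R M (sub_mod M (e ` carrier M)) \<phi> \<psi>"
  shows "mod_direct_sum R M (\<psi> ` (e ` carrier M)) ((\<one>\<^bsub>End_ring R M\<^esub> \<ominus>\<^bsub>End_ring R M\<^esub> e) ` carrier M) \<longleftrightarrow>
    e \<circ> \<psi> \<in> mod_iso R (sub_mod M (e ` carrier M)) (sub_mod M (e ` carrier M))"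
proof -
  note E = idempotent_ofD[OF e]
  have hom: "\<psi> \<in> mod_hom R (sub_mod M (e ` carrier M)) M"
    using \<psi> by (simp add: is_splitting_def)
  show ?thesis
    using bij_betw_comp_iff_direct_sum[OF E(7) E(7) hom is_splitting_inj_on[OF \<psi>] E(6)]
      mod_hom_comp[OF hom E(6)]
    by (simp add: mod_iso_def idempotent_complement_image[OF e])
qed

section \<open>Weak perspectivity and splittings with a prescribed complement\<close>

lemma weakly_perspective_imp_splitting:
  assumes wp: "weakly_perspective R M" and e: "idempotent_of (End_ring R M) e"
    and \<phi>: "split_epi R M (sub_mod M (e ` carrier M)) \<phi>"
    and iso: "mod_isomorphic R (sub_mod M (a_kernel M (sub_mod M (e ` carrier M)) \<phi>))
      (sub_mod M ((\<one>\<^bsub>End_ring R M\<^esub> \<ominus>\<^bsub>End_ring R M\<^esub> e) ` carrier M))"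
  obtains \<psi> where "is_splitting R M (sub_mod M (e ` carrier M)) \<phi> \<psi>"
    "mod_direct_sum R M (\<psi> ` (e ` carrier M)) ((\<one>\<^bsub>End_ring R M\<^esub> \<ominus>\<^bsub>End_ring R M\<^esub> e) ` carrier M)"
proof -
  note E = idempotent_ofD[OF e]
  let ?N = "sub_mod M (e ` carrier M)"
  let ?K = "a_kernel M ?N \<phi>" and ?E = "a_kernel M ?N e"
  obtain \<psi>\<^sub>0 where \<psi>\<^sub>0: "is_splitting R M ?N \<phi> \<psi>\<^sub>0"
    using \<phi> by (auto simp: split_epi_def)
  have \<phi>_hom: "\<phi> \<in> mod_hom R M ?N" and surj: "\<phi> ` carrier M = carrier ?N"
    using \<phi> by (auto simp: split_epi_def)
  have ds: "mod_direct_sum R M ?K (\<psi>\<^sub>0 ` (e ` carrier M))"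
    using splitting_direct_sum[OF E(7) \<phi> \<psi>\<^sub>0] mod_direct_sum_commute by simp
  have \<psi>\<^sub>0_iso: "\<psi>\<^sub>0 \<in> mod_iso R ?N (sub_mod M (\<psi>\<^sub>0 ` (e ` carrier M)))"
    using \<psi>\<^sub>0 is_splitting_inj_on[OF \<psi>\<^sub>0]
    by (auto simp: mod_iso_def mod_hom_def is_splitting_def bij_betw_def)
  interpret N: right_module R ?N by (rule E(7))
  have "mod_isomorphic R (sub_mod M (\<psi>\<^sub>0 ` (e ` carrier M))) ?N"
    using N.mod_iso_inv_into[OF \<psi>\<^sub>0_iso] by (auto simp: mod_isomorphic_def)
  moreover have "mod_direct_sum R M ?E (e ` carrier M)"
    using idempotent_direct_sum[OF e] mod_direct_sum_commute by simp
  \<comment> \<open>Weak perspectivity is applied to the summands \<open>Ker \<phi>\<close> and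
    \<open>Ker e\<close>. Their complements are the image of the given splitting and
    \<open>eM\<close>, which that splitting makes isomorphic.\<close>
  ultimately obtain C where C: "mod_direct_sum R M ?K C" "mod_direct_sum R M ?E C"
    using wp ds iso unfolding weakly_perspective_def idempotent_complement_image[OF e] by blast
  have C_sub: "submodule C R M" using C(1) by (simp add: mod_direct_sum_def)
  interpret C: right_module R "sub_mod M C" by (rule right_module_sub_mod[OF C_sub])
  have C_hom: "id \<in> mod_hom R (sub_mod M C) M"
    using submoduleD(2)[OF C_sub] by (intro mod_homI) auto
  \<comment> \<open>As \<open>C\<close> is a complement of \<open>Ker \<phi>\<close>, the criterion
    applied to the inclusion of \<open>C\<close> shows that \<open>\<phi>\<close> maps
    \<open>C\<close> isomorphically onto \<open>eM\<close>. The inverse of this isomorphism is the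
    required splitting, with image \<open>C\<close>.\<close>
  have "bij_betw (\<phi> \<circ> id) (carrier (sub_mod M C)) (carrier ?N)"
    using bij_betw_comp_iff_direct_sum[OF C.right_module_axioms E(7) C_hom _ \<phi>_hom surj]
      mod_direct_sum_commute[OF C(1)] by simp
  then have \<phi>_iso: "\<phi> \<in> mod_iso R (sub_mod M C) ?N"
    using mod_hom_comp[OF C_hom \<phi>_hom] by (simp add: mod_iso_def)
  let ?\<psi> = "inv_into C \<phi>"
  have \<psi>_iso: "?\<psi> \<in> mod_iso R ?N (sub_mod M C)"
    using C.mod_iso_inv_into[OF \<phi>_iso] by simp
  have \<phi>_bij: "bij_betw \<phi> C (e ` carrier M)"
    using \<phi>_iso by (simp add: mod_iso_def)
  show thesis
  proof
    show "is_splitting R M ?N \<phi> ?\<psi>"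
      using \<psi>_iso mod_hom_sub_mod[OF _ C_sub, of ?\<psi> ?N] bij_betw_inv_into_right[OF \<phi>_bij]
      by (auto simp: is_splitting_def mod_iso_def)
    have "?\<psi> ` (e ` carrier M) = C"
      using \<psi>_iso by (simp add: mod_iso_def bij_betw_def)
    then show "mod_direct_sum R M (?\<psi> ` (e ` carrier M)) ((\<one>\<^bsub>End_ring R M\<^esub> \<ominus>\<^bsub>End_ring R M\<^esub> e) ` carrier M)"
      using mod_direct_sum_commute[OF C(2)] by (simp add: idempotent_complement_image[OF e])
  qed
qed

text \<open>Let \<open>e\<close> project onto \<open>A1\<close> along \<open>A\<close>, so that
  \<open>(1 - e)M = A\<close>. Projecting onto \<open>B1\<close> along \<open>B\<close> and then
  identifying \<open>B1\<close> with \<open>A1\<close> gives a split epimorphism onto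
  \<open>eM\<close> with kernel \<open>B\<close>. The image of a suitable splitting is the common
  complement.\<close>

lemma splitting_imp_weakly_perspective:
  assumes split: "\<And>e \<phi>. \<lbrakk>idempotent_of (End_ring R M) e; split_epi R M (sub_mod M (e ` carrier M)) \<phi>;
      mod_isomorphic R (sub_mod M (a_kernel M (sub_mod M (e ` carrier M)) \<phi>))
        (sub_mod M ((\<one>\<^bsub>End_ring R M\<^esub> \<ominus>\<^bsub>End_ring R M\<^esub> e) ` carrier M))\<rbrakk> \<Longrightarrow>
      \<exists>\<psi>. is_splitting R M (sub_mod M (e ` carrier M)) \<phi> \<psi> \<and>
        mod_direct_sum R M (\<psi> ` (e ` carrier M)) ((\<one>\<^bsub>End_ring R M\<^esub> \<ominus>\<^bsub>End_ring R M\<^esub> e) ` carrier M)"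
  shows "weakly_perspective R M"
  unfolding weakly_perspective_def
proof (intro allI impI)
  fix A A1 B B1
  assume H: "mod_direct_sum R M A A1 \<and> mod_direct_sum R M B B1 \<and>
    mod_isomorphic R (sub_mod M A) (sub_mod M B) \<and> mod_isomorphic R (sub_mod M A1) (sub_mod M B1)"
  have sub: "submodule A R M" "submodule A1 R M" "submodule B R M" "submodule B1 R M"
    using H by (auto simp: mod_direct_sum_def)
  interpret A: right_module R "sub_mod M A" by (rule right_module_sub_mod[OF sub(1)])
  interpret A1: right_module R "sub_mod M A1" by (rule right_module_sub_mod[OF sub(2)])
  obtain e where e: "idempotent_of (End_ring R M) e" "e ` carrier M = A1"
    "a_kernel M (sub_mod M A1) e = A"
    using H mod_direct_sum_commute by (metis direct_sum_projection)
  obtain p where p: "idempotent_of (End_ring R M) p" "p ` carrier M = B1"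
    "a_kernel M (sub_mod M B1) p = B"
    using H mod_direct_sum_commute by (metis direct_sum_projection)
  obtain h where h: "h \<in> mod_iso R (sub_mod M A1) (sub_mod M B1)"
    using H by (auto simp: mod_isomorphic_def)
  let ?g = "inv_into A1 h"
  let ?\<phi> = "?g \<circ> p"
  have g: "?g \<in> mod_iso R (sub_mod M B1) (sub_mod M A1)"
    using A1.mod_iso_inv_into[OF h] by simp
  have h_bij: "bij_betw h A1 B1" and g_bij: "bij_betw ?g B1 A1"
    using h g by (auto simp: mod_iso_def)
  have \<phi>_hom: "?\<phi> \<in> mod_hom R M (sub_mod M A1)"
    using mod_hom_comp[of p R M "sub_mod M B1" ?g "sub_mod M A1"] idempotent_ofD(6)[OF p(1)] p(2) g
    by (simp add: mod_iso_def)
  have surj: "?\<phi> ` carrier M = A1"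
    unfolding image_comp[symmetric] p(2) using bij_betw_imp_surj_on[OF g_bij] .
  have h_hom: "h \<in> mod_hom R (sub_mod M A1) M"
    using h mod_hom_sub_mod[OF _ sub(4), of h "sub_mod M A1"] by (simp add: mod_iso_def)
  \<comment> \<open>The isomorphism from \<open>A1\<close> to \<open>B1\<close>, viewed as a map
    into \<open>M\<close>, is a splitting because \<open>p\<close> fixes \<open>B1\<close>.\<close>
  have h_spl: "is_splitting R M (sub_mod M A1) ?\<phi> h"
  proof -
    have "?\<phi> (h y) = y" if "y \<in> A1" for y
    proof -
      have "h y \<in> B1" using h_bij that by (auto simp: bij_betw_def)
      then have "p (h y) = h y" using idempotent_ofD(5)[OF p(1)] p(2) by simp
      then show ?thesis using bij_betw_inv_into_left[OF h_bij that] by simp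
    qed
    then show ?thesis using h_hom by (simp add: is_splitting_def)
  qed
  have \<phi>: "split_epi R M (sub_mod M A1) ?\<phi>"
    using \<phi>_hom surj h_spl by (auto simp: split_epi_def)
  interpret B1: right_module R "sub_mod M B1" by (rule right_module_sub_mod[OF sub(4)])
  interpret g: abelian_group_hom "sub_mod M B1" "sub_mod M A1" ?g
    using g by (intro mod_hom_abelian_group_hom[of R] A1.right_module_axioms B1.right_module_axioms)
      (simp add: mod_iso_def)
  \<comment> \<open>Composing \<open>p\<close> with the injective map \<open>?g\<close> leaves its
    kernel unchanged.\<close>
  have ker: "a_kernel M (sub_mod M A1) ?\<phi> = B"
  proof -
    have "?g y = \<zero>\<^bsub>M\<^esub> \<longleftrightarrow> y = \<zero>\<^bsub>M\<^esub>" if "y \<in> B1" for y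
      using inj_on_eq_iff[OF bij_betw_imp_inj_on[OF g_bij] that submoduleD(3)[OF sub(4)]] g.hom_zero
      by simp
    then have "x \<in> a_kernel M (sub_mod M A1) ?\<phi> \<longleftrightarrow> x \<in> a_kernel M (sub_mod M B1) p" for x
      using p(2) by (auto simp: mem_a_kernel_iff)
    then show ?thesis using p(3) by blast
  qed
  have compl: "(\<one>\<^bsub>End_ring R M\<^esub> \<ominus>\<^bsub>End_ring R M\<^esub> e) ` carrier M = A"
    using idempotent_complement_image[OF e(1)] e(2,3) by simp
  have "mod_isomorphic R (sub_mod M B) (sub_mod M A)"
    using H A.mod_iso_inv_into unfolding mod_isomorphic_def by blast
  then obtain \<psi> where \<psi>: "is_splitting R M (sub_mod M A1) ?\<phi> \<psi>" "mod_direct_sum R M (\<psi> ` A1) A"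
    using split[OF e(1), of ?\<phi>] \<phi> unfolding e(2) ker compl by blast
  \<comment> \<open>The image of every splitting of \<open>?\<phi>\<close> complements its kernel
    \<open>B\<close>; that it also complements \<open>A\<close> is the special property of this
    one.\<close>
  have "mod_direct_sum R M (\<psi> ` A1) B"
    using splitting_direct_sum[OF A1.right_module_axioms \<phi> \<psi>(1)] by (simp add: ker)
  then show "\<exists>C. mod_direct_sum R M A C \<and> mod_direct_sum R M B C"
    using \<psi>(2) mod_direct_sum_commute by blast
qed

section \<open>Split epimorphisms onto eM and units of the endomorphism ring\<close>

text \<open>Evaluated on \<open>eM\<close>, the equation \<open>euse = e\<close> says that
  \<open>s\<close> splits \<open>eu\<close>. The unit \<open>u\<close> carries
  \<open>Ker(eu)\<close> isomorphically onto \<open>Ker e = (1 - e)M\<close>.\<close>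

lemma unit_split_epi:
  assumes e: "idempotent_of (End_ring R M) e" and s: "s \<in> carrier (End_ring R M)"
    and u: "u \<in> Units (End_ring R M)"
    and eq: "e \<otimes>\<^bsub>End_ring R M\<^esub> u \<otimes>\<^bsub>End_ring R M\<^esub> s \<otimes>\<^bsub>End_ring R M\<^esub> e = e"
  shows "split_epi R M (sub_mod M (e ` carrier M)) (e \<circ> u)"
    and "mod_isomorphic R (sub_mod M (a_kernel M (sub_mod M (e ` carrier M)) (e \<circ> u)))
      (sub_mod M ((\<one>\<^bsub>End_ring R M\<^esub> \<ominus>\<^bsub>End_ring R M\<^esub> e) ` carrier M))"
proof -
  let ?N = "sub_mod M (e ` carrier M)"
  note E = idempotent_ofD[OF e]
  have uS: "u \<in> carrier (End_ring R M)" and u_bij: "bij_betw u (carrier M) (carrier M)"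
    using u by (auto simp: End_ring_Units_iff)
  have s_hom: "s \<in> mod_hom R ?N M"
    using mod_hom_domain_restrict[OF End_ring_mod_hom[OF s] submoduleD(1)[OF E(3)]] .
  have "is_splitting R M ?N (e \<circ> u) s"
    unfolding is_splitting_def
  proof (intro conjI s_hom ballI)
    fix y assume "y \<in> carrier ?N"
    then have "y \<in> carrier M" "e y = y" using E(4,5)[of y] by auto
    then show "(e \<circ> u) (s y) = y" using fun_cong[OF eq, of y] End_ring_closed[OF s] by simp
  qed
  moreover have "(e \<circ> u) ` carrier M = carrier ?N"
    unfolding image_comp[symmetric] bij_betw_imp_surj_on[OF u_bij] by simp
  ultimately show "split_epi R M ?N (e \<circ> u)"
    using mod_hom_comp[OF End_ring_mod_hom[OF uS] E(6)] by (auto simp: split_epi_def)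
  \<comment> \<open>\<open>Ker(eu)\<close> is the preimage of \<open>Ker e\<close> under the
    bijection \<open>u\<close>.\<close>
  have "bij_betw u (a_kernel M ?N (e \<circ> u)) (a_kernel M ?N e)"
    unfolding bij_betw_def
  proof
    show "inj_on u (a_kernel M ?N (e \<circ> u))"
      using u_bij by (auto simp: bij_betw_def mem_a_kernel_iff inj_on_def)
    have "y \<in> u ` a_kernel M ?N (e \<circ> u)" if y: "y \<in> a_kernel M ?N e" for y
    proof -
      obtain x where "x \<in> carrier M" "y = u x"
        using y u_bij by (auto simp: bij_betw_def mem_a_kernel_iff)
      then show ?thesis using y by (auto simp: mem_a_kernel_iff)
    qed
    then show "u ` a_kernel M ?N (e \<circ> u) = a_kernel M ?N e"
      using End_ring_closed[OF uS] by (auto simp: mem_a_kernel_iff)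
  qed
  moreover from this have "u \<in> mod_hom R (sub_mod M (a_kernel M ?N (e \<circ> u))) (sub_mod M (a_kernel M ?N e))"
    using mod_homD(2,3)[OF End_ring_mod_hom[OF uS]]
    by (intro mod_homI) (auto simp: bij_betw_def mem_a_kernel_iff)
  ultimately show "mod_isomorphic R (sub_mod M (a_kernel M ?N (e \<circ> u)))
      (sub_mod M ((\<one>\<^bsub>End_ring R M\<^esub> \<ominus>\<^bsub>End_ring R M\<^esub> e) ` carrier M))"
    by (auto simp: mod_isomorphic_def mod_iso_def idempotent_complement_image[OF e])
qed

text \<open>The unit matches the decomposition of \<open>M\<close> into \<open>Im \<psi>\<close> and
  \<open>Ker \<phi>\<close> with that into \<open>eM\<close> and \<open>(1 - e)M\<close>: it is
  \<open>\<phi>\<close> on the first summand and the given isomorphism \<open>g\<close> on the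
  second.\<close>

lemma split_epi_unit:
  assumes e: "idempotent_of (End_ring R M) e"
    and \<phi>: "split_epi R M (sub_mod M (e ` carrier M)) \<phi>"
    and iso: "mod_isomorphic R (sub_mod M (a_kernel M (sub_mod M (e ` carrier M)) \<phi>))
      (sub_mod M ((\<one>\<^bsub>End_ring R M\<^esub> \<ominus>\<^bsub>End_ring R M\<^esub> e) ` carrier M))"
  obtains u where "u \<in> Units (End_ring R M)" "\<And>x. x \<in> carrier M \<Longrightarrow> e (u x) = \<phi> x"
proof -
  let ?N = "sub_mod M (e ` carrier M)"
  let ?K = "a_kernel M ?N \<phi>" and ?E = "a_kernel M ?N e"
  note E = idempotent_ofD[OF e]
  obtain \<psi> where \<psi>: "is_splitting R M ?N \<phi> \<psi>"
    using \<phi> by (auto simp: split_epi_def)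
  have \<psi>_hom: "\<psi> \<in> mod_hom R ?N M" and \<phi>\<psi>: "\<And>y. y \<in> e ` carrier M \<Longrightarrow> \<phi> (\<psi> y) = y"
    using \<psi> by (auto simp: is_splitting_def)
  have \<phi>_hom: "\<phi> \<in> mod_hom R M ?N"
    using \<phi> by (simp add: split_epi_def)
  obtain g where g: "g \<in> mod_iso R (sub_mod M ?K) (sub_mod M ?E)"
    using iso by (auto simp: mod_isomorphic_def idempotent_complement_image[OF e])
  have g_hom: "g \<in> mod_hom R (sub_mod M ?K) (sub_mod M ?E)" and g_bij: "bij_betw g ?K ?E"
    using g by (auto simp: mod_iso_def)
  interpret N: right_module R ?N by (rule E(7))
  interpret \<phi>: abelian_group_hom M ?N \<phi>
    by (rule mod_hom_abelian_group_hom[OF right_module_axioms E(7) \<phi>_hom])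
  interpret e: abelian_group_hom M M e
    by (rule mod_hom_abelian_group_hom[OF right_module_axioms right_module_axioms End_ring_mod_hom[OF E(1)]])
  have \<phi>N: "\<phi> x \<in> e ` carrier M" "\<phi> x \<in> carrier M" "e (\<phi> x) = \<phi> x" if "x \<in> carrier M" for x
    using mod_homD(1)[OF \<phi>_hom that] E(4,5)[of "\<phi> x"] by auto
  have \<psi>M: "\<psi> y \<in> carrier M" if "y \<in> e ` carrier M" for y
    using mod_homD(1)[OF \<psi>_hom] that by simp
  have gE: "g k \<in> carrier M" "e (g k) = \<zero>\<^bsub>M\<^esub>" if "k \<in> ?K" for k
    using mod_homD(1)[OF g_hom] that by (auto simp: mem_a_kernel_iff)
  \<comment> \<open>\<open>?q\<close> is the projection onto \<open>Ker \<phi>\<close> along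
    \<open>Im \<psi>\<close>. In \<open>?u\<close> the term \<open>\<phi> x\<close> is the component
    in \<open>eM\<close> and \<open>g (?q x)\<close> the component in
    \<open>(1 - e)M\<close>.\<close>
  let ?q = "\<lambda>x. x \<ominus>\<^bsub>M\<^esub> \<psi> (\<phi> x)"
  let ?u = "\<lambda>x. \<phi> x \<oplus>\<^bsub>M\<^esub> g (?q x)"
  \<comment> \<open>From \<open>\<phi>\<psi>\<phi> x = \<phi> x\<close> it follows that
    \<open>\<phi> (?q x) + \<phi> x = \<phi> x\<close>, and cancellation gives zero.\<close>
  have qK: "?q x \<in> ?K" if "x \<in> carrier M" for x
  proof -
    have z: "\<psi> (\<phi> x) \<in> carrier M" "\<phi> (\<psi> (\<phi> x)) = \<phi> x"
      using that \<psi>M \<phi>N \<phi>\<psi> by auto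
    have q: "?q x \<in> carrier M" "?q x \<oplus>\<^bsub>M\<^esub> \<psi> (\<phi> x) = x"
      using that z by (simp_all add: M.minus_eq M.a_assoc M.l_neg)
    have "\<phi> (?q x) \<oplus>\<^bsub>M\<^esub> \<phi> x = \<phi> x"
      using mod_homD(2)[OF \<phi>_hom q(1) z(1)] q(2) z(2) by simp
    then have "\<phi> (?q x) = \<zero>\<^bsub>M\<^esub>"
      using M.add.r_cancel_one \<phi>N(2)[OF q(1)] \<phi>N(2)[OF that] by simp
    then show ?thesis
      using q(1) by (simp add: mem_a_kernel_iff)
  qed
  \<comment> \<open>\<open>e\<close> fixes the component \<open>\<phi> x\<close> and annihilates the
    values of \<open>g\<close>.\<close>
  have eu: "e (?u x) = \<phi> x" if "x \<in> carrier M" for x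
    using gE[OF qK[OF that]] \<phi>N[OF that] by simp
  have u_hom: "?u \<in> mod_hom R M M"
  proof (rule mod_homI)
    fix x y assume xy: "x \<in> carrier M" "y \<in> carrier M"
    have "?q (x \<oplus>\<^bsub>M\<^esub> y) = ?q x \<oplus>\<^bsub>M\<^esub> ?q y"
      using xy mod_homD(2)[OF \<phi>_hom] mod_homD(2)[OF \<psi>_hom] \<phi>N \<psi>M
      by (simp add: a_minus_def M.minus_add M.a_ac)
    then show "?u (x \<oplus>\<^bsub>M\<^esub> y) = ?u x \<oplus>\<^bsub>M\<^esub> ?u y"
      using xy qK gE mod_homD(2)[OF g_hom] mod_homD(2)[OF \<phi>_hom] \<phi>N by (simp add: M.a_ac)
  next
    fix a x assume ax: "a \<in> carrier R" "x \<in> carrier M"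
    have "?q (a \<odot>\<^bsub>M\<^esub> x) = a \<odot>\<^bsub>M\<^esub> ?q x"
      using ax mod_homD(3)[OF \<phi>_hom] mod_homD(3)[OF \<psi>_hom] \<phi>N \<psi>M
      by (simp add: a_minus_def smult_r_distr smult_minus)
    then show "?u (a \<odot>\<^bsub>M\<^esub> x) = a \<odot>\<^bsub>M\<^esub> ?u x"
      using ax qK gE mod_homD(3)[OF g_hom] mod_homD(3)[OF \<phi>_hom] \<phi>N by (simp add: smult_r_distr)
  qed (use qK gE \<phi>N in simp)
  have "bij_betw ?u (carrier M) (carrier M)"
  proof (rule bij_betw_imageI)
    show "inj_on ?u (carrier M)"
    proof (rule inj_onI)
      fix x y assume xy: "x \<in> carrier M" "y \<in> carrier M" "?u x = ?u y"
      \<comment> \<open>Applying \<open>e\<close> separates the two components: first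
        \<open>\<phi> x = \<phi> y\<close>, then equality of the \<open>g\<close> parts, and
        injectivity of \<open>g\<close> recovers the kernel components.\<close>
      then have \<phi>_eq: "\<phi> x = \<phi> y" using eu by metis
      have gM: "g (?q x) \<in> carrier M" "g (?q y) \<in> carrier M"
        using gE(1)[OF qK[OF xy(1)]] gE(1)[OF qK[OF xy(2)]] .
      have "g (?q x) \<oplus>\<^bsub>M\<^esub> \<phi> x = g (?q y) \<oplus>\<^bsub>M\<^esub> \<phi> x"
        using xy(3) M.a_comm[OF gM(1) \<phi>N(2)[OF xy(1)]] M.a_comm[OF gM(2) \<phi>N(2)[OF xy(2)]]
        unfolding \<phi>_eq by metis
      then have "g (?q x) = g (?q y)"
        using M.add.right_cancel[OF \<phi>N(2)[OF xy(1)] gM] by blast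
      then have "?q x = ?q y"
        using g_bij qK xy by (meson bij_betw_imp_inj_on inj_onD)
      then show "x = y"
        using xy \<phi>_eq \<psi>M \<phi>N by (simp add: a_minus_def)
    qed
    show "?u ` carrier M = carrier M"
    proof (intro equalityI subsetI)
      fix y assume "y \<in> ?u ` carrier M"
      then show "y \<in> carrier M" by (elim imageE) (simp only: mod_homD(1)[OF u_hom])
    next
      fix y assume y: "y \<in> carrier M"
      have "y \<ominus>\<^bsub>M\<^esub> e y \<in> ?E"
        using y E(2) by (simp add: mem_a_kernel_iff a_minus_def M.r_neg)
      then have "y \<ominus>\<^bsub>M\<^esub> e y \<in> g ` ?K"
        unfolding bij_betw_imp_surj_on[OF g_bij] .
      then obtain k where k: "k \<in> ?K" "g k = y \<ominus>\<^bsub>M\<^esub> e y"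
        by (elim imageE) simp
      have kM: "k \<in> carrier M" "\<phi> k = \<zero>\<^bsub>M\<^esub>" using k by (auto simp: mem_a_kernel_iff)
      \<comment> \<open>The preimage is assembled from the two components of \<open>y\<close>:
        \<open>e y\<close> is lifted by \<open>\<psi>\<close>, and \<open>y - e y\<close> is lifted
        through \<open>g\<close> to \<open>k\<close>.\<close>
      let ?x = "\<psi> (e y) \<oplus>\<^bsub>M\<^esub> k"
      have \<psi>ey: "\<psi> (e y) \<in> carrier M" using \<psi>M y by simp
      have \<phi>x: "\<phi> ?x = e y"
        using mod_homD(2)[OF \<phi>_hom \<psi>ey kM(1)] kM \<phi>\<psi>[of "e y"] y by simp
      then have "?q ?x = k"
        using \<psi>ey kM by (simp add: a_minus_def M.a_ac M.r_neg M.r_neg1 M.r_neg2)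
      then have "?u ?x = y"
        using \<phi>x k y by (simp add: a_minus_def M.a_lcomm M.r_neg)
      then show "y \<in> ?u ` carrier M"
        using M.a_closed[OF \<psi>ey kM(1)] by (rule image_eqI[OF sym])
    qed
  qed
  then have "restrict ?u (carrier M) \<in> Units (End_ring R M)"
    using restrict_in_End_ring[OF u_hom] by (simp add: End_ring_Units_iff bij_betw_def)
  then show thesis
    using eu by (intro that[of "restrict ?u (carrier M)"]) auto
qed

text \<open>A splitting \<open>\<psi>\<close> yields the endomorphism \<open>\<psi>e\<close>, and an
  endomorphism \<open>t\<close> with \<open>eute = e\<close> yields a splitting by restriction to
  \<open>eM\<close>. The two preceding lemmas exchange \<open>\<phi>\<close> and
  \<open>eu\<close>.\<close>

lemma splitting_iff_corner_units:
  "(\<forall>e \<phi>. idempotent_of (End_ring R M) e \<and> split_epi R M (sub_mod M (e ` carrier M)) \<phi> \<and>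
      mod_isomorphic R (sub_mod M (a_kernel M (sub_mod M (e ` carrier M)) \<phi>))
        (sub_mod M ((\<one>\<^bsub>End_ring R M\<^esub> \<ominus>\<^bsub>End_ring R M\<^esub> e) ` carrier M)) \<longrightarrow>
      (\<exists>\<psi>. is_splitting R M (sub_mod M (e ` carrier M)) \<phi> \<psi> \<and>
         e \<circ> \<psi> \<in> mod_iso R (sub_mod M (e ` carrier M)) (sub_mod M (e ` carrier M)))) \<longleftrightarrow>
   (\<forall>e s u. idempotent_of (End_ring R M) e \<and> s \<in> carrier (End_ring R M) \<and> u \<in> Units (End_ring R M) \<and>
      e \<otimes>\<^bsub>End_ring R M\<^esub> u \<otimes>\<^bsub>End_ring R M\<^esub> s \<otimes>\<^bsub>End_ring R M\<^esub> e = e \<longrightarrow>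
      (\<exists>t\<in>carrier (End_ring R M). e \<otimes>\<^bsub>End_ring R M\<^esub> u \<otimes>\<^bsub>End_ring R M\<^esub> t \<otimes>\<^bsub>End_ring R M\<^esub> e = e \<and>
         e \<otimes>\<^bsub>End_ring R M\<^esub> t \<otimes>\<^bsub>End_ring R M\<^esub> e \<in> Units (corner_ring (End_ring R M) e)))"
  (is "?splitting \<longleftrightarrow> ?units")
proof
  interpret S: ring "End_ring R M" by (rule End_ring_ring)
  assume H: ?splitting
  show ?units
  proof (intro allI impI, elim conjE)
    fix e s u
    assume e: "idempotent_of (End_ring R M) e" and s: "s \<in> carrier (End_ring R M)"
      and u: "u \<in> Units (End_ring R M)"
      and eq: "e \<otimes>\<^bsub>End_ring R M\<^esub> u \<otimes>\<^bsub>End_ring R M\<^esub> s \<otimes>\<^bsub>End_ring R M\<^esub> e = e"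
    let ?N = "sub_mod M (e ` carrier M)"
    note E = idempotent_ofD[OF e]
    have uS: "u \<in> carrier (End_ring R M)" using u by (simp add: End_ring_Units_iff)
    obtain \<psi> where \<psi>: "is_splitting R M ?N (e \<circ> u) \<psi>" "e \<circ> \<psi> \<in> mod_iso R ?N ?N"
      using H e unit_split_epi[OF e s u eq] by blast
    \<comment> \<open>Precomposition with \<open>e\<close> extends the splitting from
      \<open>eM\<close> to all of \<open>M\<close>.\<close>
    let ?t = "restrict (\<psi> \<circ> e) (carrier M)"
    have t: "?t \<in> carrier (End_ring R M)"
      using mod_hom_comp[OF E(6)] \<psi>(1) by (intro restrict_in_End_ring) (auto simp: is_splitting_def)
    have "e \<otimes>\<^bsub>End_ring R M\<^esub> u \<otimes>\<^bsub>End_ring R M\<^esub> ?t \<otimes>\<^bsub>End_ring R M\<^esub> e = e"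
    proof (rule End_ring_eqI)
      fix x assume x: "x \<in> carrier M"
      have "e x \<in> carrier M" "?t (e x) \<in> carrier M"
        using x End_ring_closed[OF E(1)] End_ring_closed[OF t] by auto
      moreover have "e (u (\<psi> (e x))) = e x"
        using \<psi>(1) x by (simp add: is_splitting_def)
      ultimately show "(e \<otimes>\<^bsub>End_ring R M\<^esub> u \<otimes>\<^bsub>End_ring R M\<^esub> ?t \<otimes>\<^bsub>End_ring R M\<^esub> e) x = e x"
        using x E(2) by simp
    qed (use E(1) uS t in auto)
    \<comment> \<open>On \<open>eM\<close> the inner \<open>e\<close> acts as the identity, so
      \<open>?t\<close> and \<open>\<psi>\<close> agree there.\<close>
    moreover have "e \<circ> ?t \<in> mod_iso R ?N ?N"
      using \<psi>(2)
    proof (subst mod_iso_cong[OF E(7), of _ "e \<circ> \<psi>"])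
      fix x assume "x \<in> carrier ?N"
      then show "(e \<circ> ?t) x = (e \<circ> \<psi>) x" using E(4,5)[of x] by simp
    qed
    ultimately show "\<exists>t\<in>carrier (End_ring R M).
        e \<otimes>\<^bsub>End_ring R M\<^esub> u \<otimes>\<^bsub>End_ring R M\<^esub> t \<otimes>\<^bsub>End_ring R M\<^esub> e = e \<and>
        e \<otimes>\<^bsub>End_ring R M\<^esub> t \<otimes>\<^bsub>End_ring R M\<^esub> e \<in> Units (corner_ring (End_ring R M) e)"
      using t corner_ring_Units_iff[OF e t] by blast
  qed
next
  interpret S: ring "End_ring R M" by (rule End_ring_ring)
  assume H: ?units
  show ?splitting
  proof (intro allI impI, elim conjE)
    fix e \<phi>
    let ?N = "sub_mod M (e ` carrier M)"
    assume e: "idempotent_of (End_ring R M) e" and \<phi>: "split_epi R M ?N \<phi>"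
      and iso: "mod_isomorphic R (sub_mod M (a_kernel M ?N \<phi>))
        (sub_mod M ((\<one>\<^bsub>End_ring R M\<^esub> \<ominus>\<^bsub>End_ring R M\<^esub> e) ` carrier M))"
    note E = idempotent_ofD[OF e]
    obtain u where u: "u \<in> Units (End_ring R M)" "\<And>x. x \<in> carrier M \<Longrightarrow> e (u x) = \<phi> x"
      by (rule split_epi_unit[OF e \<phi> iso]) blast
    have uS: "u \<in> carrier (End_ring R M)" using u by (simp add: End_ring_Units_iff)
    \<comment> \<open>Since \<open>eu\<close> agrees with \<open>\<phi>\<close> on \<open>M\<close>,
      the element \<open>eufe\<close> acts as \<open>\<phi>fe\<close>.\<close>
    have eut: "(e \<otimes>\<^bsub>End_ring R M\<^esub> u \<otimes>\<^bsub>End_ring R M\<^esub> f \<otimes>\<^bsub>End_ring R M\<^esub> e) x = \<phi> (f (e x))"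
      if "f \<in> carrier (End_ring R M)" "x \<in> carrier M" for f x
      using that u(2) End_ring_closed[OF E(1)] End_ring_closed[OF that(1)] by simp
    obtain \<psi> where \<psi>: "is_splitting R M ?N \<phi> \<psi>"
      using \<phi> by (auto simp: split_epi_def)
    \<comment> \<open>An arbitrary splitting of \<open>\<phi>\<close> supplies the \<open>s\<close>
      with \<open>euse = e\<close> from which the hypothesis produces a better
      \<open>t\<close>.\<close>
    let ?s = "restrict (\<psi> \<circ> e) (carrier M)"
    have s: "?s \<in> carrier (End_ring R M)"
      using mod_hom_comp[OF E(6)] \<psi> by (intro restrict_in_End_ring) (auto simp: is_splitting_def)
    have "e \<otimes>\<^bsub>End_ring R M\<^esub> u \<otimes>\<^bsub>End_ring R M\<^esub> ?s \<otimes>\<^bsub>End_ring R M\<^esub> e = e"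
    proof (rule End_ring_eqI)
      fix x assume x: "x \<in> carrier M"
      then show "(e \<otimes>\<^bsub>End_ring R M\<^esub> u \<otimes>\<^bsub>End_ring R M\<^esub> ?s \<otimes>\<^bsub>End_ring R M\<^esub> e) x = e x"
        unfolding eut[OF s x] using E(2) \<psi> End_ring_closed[OF E(1)] by (simp add: is_splitting_def)
    qed (use E(1) uS s in auto)
    then obtain t where t: "t \<in> carrier (End_ring R M)"
      and eq: "e \<otimes>\<^bsub>End_ring R M\<^esub> u \<otimes>\<^bsub>End_ring R M\<^esub> t \<otimes>\<^bsub>End_ring R M\<^esub> e = e"
      and unit: "e \<otimes>\<^bsub>End_ring R M\<^esub> t \<otimes>\<^bsub>End_ring R M\<^esub> e \<in> Units (corner_ring (End_ring R M) e)"
      using H e s u(1) by blast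
    \<comment> \<open>\<open>t\<close> itself serves as the new splitting, since only its values on
      \<open>eM\<close> matter.\<close>
    have "t \<in> mod_hom R ?N M"
      using mod_hom_domain_restrict[OF End_ring_mod_hom[OF t] submoduleD(1)[OF E(3)]] .
    moreover have "\<phi> (t y) = y" if "y \<in> e ` carrier M" for y
      using eut[OF t, of y] eq E(4,5)[OF that] by simp
    ultimately have "is_splitting R M ?N \<phi> t"
      by (simp add: is_splitting_def)
    then show "\<exists>\<psi>. is_splitting R M ?N \<phi> \<psi> \<and> e \<circ> \<psi> \<in> mod_iso R ?N ?N"
      using corner_ring_Units_iff[OF e t] unit by blast
  qed
qed

end

section \<open>Equivalence of the four conditions\<close>

theorem theorem3p4:
  fixes R :: "('r, 'a) ring_scheme"
    and M :: "('r, 'm, 'k) module_scheme"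
    and S :: "('m \<Rightarrow> 'm) ring"
  assumes "right_module R M"
    and "S = End_ring R M"
  shows
    "(weakly_perspective R M \<longleftrightarrow>
       (\<forall>e \<phi>. idempotent_of S e \<and> split_epi R M (sub_mod M (e ` carrier M)) \<phi> \<and>
          mod_isomorphic R (sub_mod M (a_kernel M (sub_mod M (e ` carrier M)) \<phi>))
            (sub_mod M ((\<one>\<^bsub>S\<^esub> \<ominus>\<^bsub>S\<^esub> e) ` carrier M)) \<longrightarrow>
          (\<exists>\<psi>. is_splitting R M (sub_mod M (e ` carrier M)) \<phi> \<psi> \<and>
             mod_direct_sum R M (\<psi> ` (e ` carrier M)) ((\<one>\<^bsub>S\<^esub> \<ominus>\<^bsub>S\<^esub> e) ` carrier M)))) \<and>
     (weakly_perspective R M \<longleftrightarrow>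
       (\<forall>e \<phi>. idempotent_of S e \<and> split_epi R M (sub_mod M (e ` carrier M)) \<phi> \<and>
          mod_isomorphic R (sub_mod M (a_kernel M (sub_mod M (e ` carrier M)) \<phi>))
            (sub_mod M ((\<one>\<^bsub>S\<^esub> \<ominus>\<^bsub>S\<^esub> e) ` carrier M)) \<longrightarrow>
          (\<exists>\<psi>. is_splitting R M (sub_mod M (e ` carrier M)) \<phi> \<psi> \<and>
             e \<circ> \<psi> \<in> mod_iso R (sub_mod M (e ` carrier M)) (sub_mod M (e ` carrier M))))) \<and>
     (weakly_perspective R M \<longleftrightarrow>
       (\<forall>e s u. idempotent_of S e \<and> s \<in> carrier S \<and> u \<in> Units S \<and>
          e \<otimes>\<^bsub>S\<^esub> u \<otimes>\<^bsub>S\<^esub> s \<otimes>\<^bsub>S\<^esub> e = e \<longrightarrow>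
          (\<exists>t\<in>carrier S. e \<otimes>\<^bsub>S\<^esub> u \<otimes>\<^bsub>S\<^esub> t \<otimes>\<^bsub>S\<^esub> e = e \<and>
             e \<otimes>\<^bsub>S\<^esub> t \<otimes>\<^bsub>S\<^esub> e \<in> Units (corner_ring S e))))"
proof -
  interpret right_module R M by fact
  have "weakly_perspective R M \<longleftrightarrow>
    (\<forall>e \<phi>. idempotent_of S e \<and> split_epi R M (sub_mod M (e ` carrier M)) \<phi> \<and>
       mod_isomorphic R (sub_mod M (a_kernel M (sub_mod M (e ` carrier M)) \<phi>))
         (sub_mod M ((\<one>\<^bsub>S\<^esub> \<ominus>\<^bsub>S\<^esub> e) ` carrier M)) \<longrightarrow>
       (\<exists>\<psi>. is_splitting R M (sub_mod M (e ` carrier M)) \<phi> \<psi> \<and>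
          mod_direct_sum R M (\<psi> ` (e ` carrier M)) ((\<one>\<^bsub>S\<^esub> \<ominus>\<^bsub>S\<^esub> e) ` carrier M)))"
    (is "_ \<longleftrightarrow> ?complement")
  proof
    assume "weakly_perspective R M"
    then show ?complement
      unfolding assms(2) by (blast elim: weakly_perspective_imp_splitting)
  next
    assume ?complement
    then show "weakly_perspective R M"
      unfolding assms(2) by (intro splitting_imp_weakly_perspective) blast
  qed
  \<comment> \<open>For fixed \<open>e\<close> and \<open>\<phi>\<close>, the complement property
    and the automorphism property hold for the same splittings, so the equivalence passes through
    the quantifiers.\<close>
  moreover have "?complement \<longleftrightarrow>
    (\<forall>e \<phi>. idempotent_of S e \<and> split_epi R M (sub_mod M (e ` carrier M)) \<phi> \<and>
       mod_isomorphic R (sub_mod M (a_kernel M (sub_mod M (e ` carrier M)) \<phi>))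
         (sub_mod M ((\<one>\<^bsub>S\<^esub> \<ominus>\<^bsub>S\<^esub> e) ` carrier M)) \<longrightarrow>
       (\<exists>\<psi>. is_splitting R M (sub_mod M (e ` carrier M)) \<phi> \<psi> \<and>
          e \<circ> \<psi> \<in> mod_iso R (sub_mod M (e ` carrier M)) (sub_mod M (e ` carrier M))))"
    unfolding assms(2) using splitting_complement_iff by blast
  \<comment> \<open>The condition on corner units is compared with the automorphism condition as a
    whole, because \<open>\<phi>\<close> and \<open>u\<close> must be traded for one
    another.\<close>
  ultimately show ?thesis
    unfolding assms(2) using splitting_iff_corner_units by blast
qed

end
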